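(* Let $f:\mathbb{C}\to\mathbb{C}$ be a transcendental entire function such that, for some $r(f)>1$, $$m(r)\le M(r)^{1-K/\log r},\quad\text{for all } r\ge r(f),$$ where $K=4\log 4$. Then $f$ is log-regular. In particular, if $f$ is a transcendental entire function in the Eremenko--Lyubich class $\mathcal{B}$, then $f$ is log-regular.
   Context: For $r>0$ put $M(r)=M(r,f)=\max_{|z|=r}|f(z)|$ and $m(r)=m(r,f)=\min_{|z|=r}|f(z)|$. A transcendental entire function $f$ is log-regular if there exists $c>0$ such that the function $\phi(t)=\log M(e^t)$ satisfies $$\frac{\phi'(t)}{\phi(t)}\ge\frac{1+c}{t},\quad\text{for all sufficiently large } t,$$ where $\phi'$ denotes the right derivative of the convex function $\phi$. The class $\mathcal{B}$ consists of the transcendental entire functions whose set of singular values (that is, critical values and finite asymptotic values) is bounded. *)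

theory Defs
  imports "HOL-Complex_Analysis.Complex_Analysis"
begin

definition transcendental_entire :: "(complex \<Rightarrow> complex) \<Rightarrow> bool" where
  "transcendental_entire f \<longleftrightarrow> f holomorphic_on UNIV \<and> (\<nexists>p. \<forall>z. f z = poly p z)"

text \<open>For continuous \<open>f\<close> and \<open>r \<ge> 0\<close> the circle is compact and nonempty, so the supremum and
  infimum below are attained.\<close>

definition max_modulus :: "(complex \<Rightarrow> complex) \<Rightarrow> real \<Rightarrow> real" where
  "max_modulus f r = (SUP z\<in>sphere 0 r. cmod (f z))"

definition min_modulus :: "(complex \<Rightarrow> complex) \<Rightarrow> real \<Rightarrow> real" where
  "min_modulus f r = (INF z\<in>sphere 0 r. cmod (f z))"

definition log_max_modulus :: "(complex \<Rightarrow> complex) \<Rightarrow> real \<Rightarrow> real" where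
  "log_max_modulus f t = ln (max_modulus f (exp t))"

text \<open>The right derivative \<open>D\<close> is required to exist; for entire functions this is automatic, as
  \<open>log_max_modulus f\<close> is then convex.\<close>

definition log_regular :: "(complex \<Rightarrow> complex) \<Rightarrow> bool" where
  "log_regular f \<longleftrightarrow> transcendental_entire f \<and>
     (\<exists>c>0. \<forall>\<^sub>F t in at_top. \<exists>D. (log_max_modulus f has_real_derivative D) (at_right t) \<and>
        D / log_max_modulus f t \<ge> (1 + c) / t)"

definition critical_values :: "(complex \<Rightarrow> complex) \<Rightarrow> complex set" where
  "critical_values f = f ` {z. deriv f z = 0}"

definition asymptotic_values :: "(complex \<Rightarrow> complex) \<Rightarrow> complex set" where
  "asymptotic_values f = {a. \<exists>\<gamma> :: real \<Rightarrow> complex. continuous_on {0..} \<gamma> \<and>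
     filterlim \<gamma> at_infinity at_top \<and> ((\<lambda>t. f (\<gamma> t)) \<longlongrightarrow> a) at_top}"

definition eremenko_lyubich_class :: "(complex \<Rightarrow> complex) set" where
  "eremenko_lyubich_class =
     {f. transcendental_entire f \<and> bounded (critical_values f \<union> asymptotic_values f)}"

end

theory Submission
  imports Defs "HOL-Real_Asymp.Real_Asymp"
begin

text \<open>
  Let \<open>\<phi> t = log M(exp t)\<close>, which is convex. If \<open>t \<phi>'(t) < (1 + c) \<phi>(t)\<close> for some large \<open>t\<close> and a small
  constant \<open>c\<close>, then convexity forces \<open>\<phi>\<close> to stay within \<open>c \<phi>(t)\<close> of the linear function \<open>N x\<close>,
  \<open>N = \<phi>(t) / t\<close>, on all of \<open>[0, t]\<close>. Write \<open>f = P g\<close>, where the polynomial \<open>P\<close> carries the zeros of \<open>f\<close> in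
  the disc of radius \<open>exp (3 t / 4)\<close>. There are \<open>O(N)\<close> zeros, and by the Borel--Caratheodory inequality
  \<open>log \<bar>g\<bar>\<close> is almost constant for \<open>\<bar>z\<bar> \<le> exp (5 t / 8)\<close>. Comparing slopes, only a small multiple of \<open>N\<close>
  of the zeros have modulus between \<open>exp (7 t / 16)\<close> and \<open>exp (9 t / 16)\<close>; averaging over radii gives a
  radius \<open>r\<close> between \<open>exp (t / 2)\<close> and \<open>2 exp (t / 2)\<close> for which these zeros are harmless, so that
  \<open>log m(r) \<ge> log M(r) - N\<close>. As \<open>log M(r) / log r\<close> is close to \<open>N\<close>, this contradicts the hypothesis on \<open>m\<close>
  for every \<open>K \<ge> 2\<close>.

  For \<open>f\<close> in the Eremenko--Lyubich class the minimum modulus is bounded. Otherwise \<open>\<bar>f\<bar>\<close> exceeds a bound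
  \<open>exp L\<close> for the singular values on some circle. Beyond \<open>exp L\<close> paths can be lifted through \<open>f\<close>, and \<open>exp\<close>
  on the half-plane \<open>Re w > L\<close> lifts to a map \<open>G\<close> with \<open>f \<circ> G = exp\<close>. Going once around the circle
  shows that \<open>G\<close> has a period in \<open>2 \<pi> \<i> \<int>\<close>, hence covers a neighbourhood of \<open>\<infinity>\<close>; so \<open>f\<close> tends to \<open>\<infinity>\<close>
  at \<open>\<infinity>\<close> and is a polynomial.
\<close>

subsection \<open>Convexity of the maximum modulus\<close>

lemma entire_continuous_on: "f holomorphic_on UNIV \<Longrightarrow> continuous_on S f"
  by (meson holomorphic_on_imp_continuous_on continuous_on_subset subset_UNIV)

lemma max_modulus_attained:
  assumes "continuous_on (sphere 0 r) f" "0 \<le> r"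
  obtains z where "cmod z = r" "cmod (f z) = max_modulus f r"
proof -
  have "sphere (0::complex) r \<noteq> {}" using assms(2) by simp
  then obtain z where z: "z \<in> sphere 0 r" "\<And>y. y \<in> sphere 0 r \<Longrightarrow> cmod (f y) \<le> cmod (f z)"
    using continuous_attains_sup[OF compact_sphere _ continuous_on_norm[OF assms(1)]] by blast
  then have "max_modulus f r = cmod (f z)"
    unfolding max_modulus_def by (intro cSup_eq_maximum) auto
  with z show thesis using that by simp
qed

lemma norm_le_max_modulus:
  assumes "continuous_on (sphere 0 r) f" "cmod z = r"
  shows "cmod (f z) \<le> max_modulus f r"
proof -
  have "compact ((\<lambda>z. cmod (f z)) ` sphere 0 r)"
    by (intro compact_continuous_image continuous_on_norm assms(1)) auto
  then show ?thesis unfolding max_modulus_def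
    using assms(2) by (intro cSUP_upper bounded_imp_bdd_above compact_imp_bounded) auto
qed

lemma min_modulus_greatest:
  assumes "0 \<le> r" "\<And>z. cmod z = r \<Longrightarrow> B \<le> cmod (f z)"
  shows "B \<le> min_modulus f r"
proof -
  have "sphere (0::complex) r \<noteq> {}" using assms(1) by simp
  then show ?thesis unfolding min_modulus_def using assms(2) by (intro cINF_greatest) auto
qed

lemma min_modulus_le:
  assumes "cmod z = r"
  shows "min_modulus f r \<le> cmod (f z)"
  unfolding min_modulus_def by (rule cINF_lower) (use assms in \<open>auto intro!: bdd_belowI[of _ 0]\<close>)

lemma norm_le_max_modulus_disc:
  assumes "f holomorphic_on UNIV" "cmod z \<le> r"
  shows "cmod (f z) \<le> max_modulus f r"
proof (rule maximum_modulus_frontier[of f "cball 0 r"])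
  show "f holomorphic_on interior (cball 0 r)"
    using assms(1) holomorphic_on_subset by blast
  show "continuous_on (closure (cball 0 r)) f"
    using assms(1) by (rule entire_continuous_on)
  show "cmod (f w) \<le> max_modulus f r" if "w \<in> frontier (cball 0 r)" for w
  proof (cases "r = 0")
    case False
    then have "0 < r" using assms(2) norm_ge_zero[of z] by linarith
    with that have "cmod w = r" by (simp add: frontier_cball)
    then show ?thesis
      by (meson assms(1) entire_continuous_on norm_le_max_modulus)
  next
    case True
    with that have "cmod w = r" using frontier_subset_closed[of "cball (0::complex) 0"] by auto
    then show ?thesis
      by (meson assms(1) entire_continuous_on norm_le_max_modulus)
  qed
qed (use assms(2) in auto)

lemma transcendental_entire_nonconstant:
  assumes "transcendental_entire f"
  shows "\<not> f constant_on UNIV"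
proof
  assume "f constant_on UNIV"
  then obtain c where "\<And>z. f z = c" by (auto simp: constant_on_def)
  then have "\<forall>z. f z = poly [:c:] z" by simp
  then show False using assms unfolding transcendental_entire_def by blast
qed

text \<open>Keeps the logarithm in \<open>log_max_modulus\<close> meaningful: a vanishing maximum on
  one circle would make \<open>f\<close> zero on a disc and, by the identity theorem,
  everywhere.\<close>

lemma max_modulus_pos:
  assumes "f holomorphic_on UNIV" "\<not> f constant_on UNIV" "0 < r"
  shows "0 < max_modulus f r"
proof (rule ccontr)
  assume "\<not> ?thesis"
  then have z: "f z = 0" if "z \<in> ball 0 r" for z
    using norm_le_max_modulus_disc[OF assms(1), of z r] that
      by (smt (verit, best) mem_ball_0 norm_eq_zero norm_ge_zero)
  have "f z = 0" for z
    by (rule analytic_continuation_open[of "ball 0 r" UNIV f "\<lambda>_. 0"])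
      (use z assms in \<open>auto\<close>)
  then show False using assms(2) by (auto simp: constant_on_def)
qed

lemma max_modulus_at_top:
  assumes "f holomorphic_on UNIV" "\<not> f constant_on UNIV"
  shows "filterlim (max_modulus f) at_top at_top"
  unfolding filterlim_at_top
proof
  fix Z
  have "\<not> bounded (range f)" using Liouville_theorem assms by blast
  then have "\<exists>z. cmod (f z) > Z" by (auto simp: bounded_iff not_le)
  then obtain z where z: "cmod (f z) > Z" ..
  have "Z \<le> max_modulus f r" if "r \<ge> cmod z" for r
    using norm_le_max_modulus_disc[OF assms(1) that] z by linarith
  then show "\<forall>\<^sub>F r in at_top. Z \<le> max_modulus f r"
    by (meson eventually_at_top_linorder)
qed

text \<open>Hadamard's three circles theorem. After the substitution \<open>z = exp w\<close> the circles become
  vertical lines, and \<open>\<bar>f (exp w) * exp (- l w)\<bar>\<close> has period \<open>2 \<pi> \<i>\<close> for every real \<open>l\<close>, so that it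
  attains its maximum on the strip.\<close>

lemma three_lines_periodic:
  fixes F :: "complex \<Rightarrow> complex"
  assumes hol: "F holomorphic_on UNIV" and "a < b"
    and per: "\<And>w. cmod (F (w + 2 * pi * \<i>)) = cmod (F w)"
    and bd: "\<And>w. Re w = a \<or> Re w = b \<Longrightarrow> cmod (F w) \<le> B"
    and w: "a \<le> Re w" "Re w \<le> b"
  shows "cmod (F w) \<le> B"
proof -
  have perint: "cmod (F (w + of_int k * (2 * pi * \<i>))) = cmod (F w)" for w and k :: int
  proof (induction k rule: int_induct[where k=0])
    case (step1 i)
    then show ?case using per[of "w + of_int i * (2 * pi * \<i>)"] by (simp add: algebra_simps)
  next
    case (step2 i)
    then show ?case using per[of "w + of_int (i-1) * (2 * pi * \<i>)"] by (simp add: algebra_simps)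
  qed simp
  define R where "R = cbox (Complex a 0) (Complex b (2*pi))"
  have "R \<noteq> {}" proof -
    have "Complex a 0 \<in> R" using \<open>a < b\<close> by (auto simp: R_def in_cbox_complex_iff)
    then show ?thesis by blast
  qed
  moreover have cont: "continuous_on UNIV F" using hol by (rule holomorphic_on_imp_continuous_on)
  ultimately obtain u where u: "u \<in> R" "\<And>v. v \<in> R \<Longrightarrow> cmod (F v) \<le> cmod (F u)"
    using continuous_attains_sup[of R "\<lambda>w. cmod (F w)"] compact_cbox
    by (metis R_def continuous_on_norm continuous_on_subset subset_UNIV)
  have max: "cmod (F v) \<le> cmod (F u)" if "a \<le> Re v" "Re v \<le> b" for v
  proof -
    define k where "k = \<lfloor>Im v / (2*pi)\<rfloor>"
    define v' where "v' = v + of_int (-k) * (2 * pi * \<i>)"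
    have "of_int k \<le> Im v / (2*pi)" "Im v / (2*pi) \<le> of_int k + 1"
      unfolding k_def by linarith+
    then have "0 \<le> Im v - of_int k * (2*pi)" "Im v - of_int k * (2*pi) \<le> 2*pi"
      by (auto simp: field_simps)
    then have "v' \<in> R" using that by (auto simp: R_def v'_def in_cbox_complex_iff)
    then show ?thesis using u(2)[of v'] perint[of v "-k"] unfolding v'_def by simp
  qed
  have "cmod (F u) \<le> B"
  proof (cases "Re u = a \<or> Re u = b")
    case True then show ?thesis by (rule bd)
  next
    case False
    \<comment> \<open>An interior maximum makes \<open>F\<close> constant on the strip and hence on
      the plane, so the bound on the line \<open>Re w = a\<close> applies to that constant.\<close>
    define S where "S = {v. a < Re v} \<inter> {v. Re v < b}"
    have uS: "u \<in> S" using u(1) False by (auto simp: R_def S_def in_cbox_complex_iff)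
    have S: "open S" "convex S" unfolding S_def
      by (auto intro!: open_Int open_halfspace_Re_gt open_halfspace_Re_lt convex_Int convex_halfspace_Re_gt convex_halfspace_Re_lt)
    have "F holomorphic_on S" using hol holomorphic_on_subset by blast
    from maximum_modulus_principle[OF this S(1) convex_connected[OF S(2)] S(1) order_refl uS]
    have "F constant_on S" using max by (auto simp: S_def)
    then obtain c where c: "\<And>v. v \<in> S \<Longrightarrow> F v = c" by (auto simp: constant_on_def)
    have "F v = c" for v
      by (rule analytic_continuation_open[of S UNIV F "\<lambda>_. c"]) (use S uS hol c in auto)
    then show ?thesis using bd[of "Complex a 0"] by simp
  qed
  then show ?thesis using max[OF w] by linarith
qed
lemma log_max_modulus_convex:
  assumes hol: "f holomorphic_on UNIV" and nc: "\<not> f constant_on UNIV"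
  shows "convex_on UNIV (log_max_modulus f)"
proof (rule convex_onI)
  fix s x y :: real assume s: "0 < s" "s < 1"
  let ?p = "log_max_modulus f"
  have M: "cmod (f (exp w)) \<le> exp (?p (Re w))" for w
    using norm_le_max_modulus_disc[OF hol, of "exp w" "exp (Re w)"] max_modulus_pos[OF hol nc, of "exp (Re w)"]
    by (simp add: log_max_modulus_def)
  have main: "?p ((1-s)*x + s*y) \<le> (1-s) * ?p x + s * ?p y" if "x < y" "0 < s" "s < 1" for x y s :: real
  proof -
    \<comment> \<open>The slope of the chord is the exponent for which the bounds for
      \<open>F\<close> on the two boundary lines coincide.\<close>
    define l where "l = (?p y - ?p x) / (y - x)"
    define F where "F = (\<lambda>w. f (exp w) * exp (- of_real l * w))"
    define B where "B = exp (?p x - l * x)"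
    define t where "t = (1-s)*x + s*y"
    have t: "x \<le> t" "t \<le> y" 
    proof -
      have "t - x = s * (y - x)" "y - t = (1-s) * (y-x)" by (auto simp: t_def algebra_simps)
      then show "x \<le> t" "t \<le> y" using that by (smt (verit) mult_pos_pos)+
    qed
    have Fn: "cmod (F w) = cmod (f (exp w)) * exp (- l * Re w)" for w
      by (simp add: F_def norm_mult)
    have ly: "?p y - l * y = ?p x - l * x" using that by (simp add: l_def field_simps)
    have "continuous_on (sphere 0 (exp t)) f"
      using hol by (rule entire_continuous_on)
    from max_modulus_attained[OF this] obtain z where z: "cmod z = exp t" "cmod (f z) = max_modulus f (exp t)"
      by auto
    then have zn: "z \<noteq> 0" by auto
    have z1: "Re (Ln z) = t" using z zn by simp
    have "cmod (F (Ln z)) \<le> B"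
    proof (rule three_lines_periodic[of F x y])
      show "F holomorphic_on UNIV" unfolding F_def
        by (intro holomorphic_intros holomorphic_on_compose_gen[OF _ hol, unfolded o_def]) auto
      show "cmod (F (w + 2 * pi * \<i>)) = cmod (F w)" for w
        unfolding Fn by (simp add: exp_add)
      show "cmod (F w) \<le> B" if "Re w = x \<or> Re w = y" for w
      proof -
        have "cmod (F w) \<le> exp (?p (Re w)) * exp (- l * Re w)"
          unfolding Fn by (intro mult_right_mono M) auto
        also have "\<dots> = B" using that ly by (auto simp: B_def simp flip: exp_add)
        finally show ?thesis .
      qed
    qed (use that t z1 in auto)
    then have "max_modulus f (exp t) * exp (- l * t) \<le> B"
      unfolding Fn z1 using z zn by simp
    moreover have "max_modulus f (exp t) = exp (?p t)"
      using max_modulus_pos[OF hol nc, of "exp t"] by (simp add: log_max_modulus_def)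
    ultimately have "?p t - l * t \<le> ?p x - l * x"
      unfolding B_def by (simp flip: exp_add)
    moreover have "t - x = s * (y - x)" by (simp add: t_def algebra_simps)
    moreover have "?p t - l * t = ?p t - l * (t - x) - l * x" by (simp add: algebra_simps)
    ultimately have "?p t \<le> ?p x + l * (s * (y - x))" by simp
    also have "l * (s * (y - x)) = s * (?p y - ?p x)" using that by (simp add: l_def)
    finally show ?thesis by (simp add: t_def algebra_simps)
  qed
  show "?p ((1 - s) *\<^sub>R x + s *\<^sub>R y) \<le> (1 - s) * ?p x + s * ?p y"
  proof (cases x y rule: linorder_cases)
    case less then show ?thesis using main s by simp
  next
    case equal then show ?thesis by (simp add: algebra_simps flip: distrib_left)
  next
    case greater
    from main[of y x "1-s", OF this] s show ?thesis by (simp add: algebra_simps)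
  qed
qed auto

text \<open>The difference quotients to the right of \<open>t\<close> are increasing and bounded
  below by those to the left. Their infimum is therefore the right derivative, and it dominates
  every slope from the left.\<close>

lemma convex_on_has_right_derivative:
  fixes p :: "real \<Rightarrow> real"
  assumes "convex_on UNIV p"
  obtains D where "(p has_real_derivative D) (at_right t)" "\<And>s. s \<le> t \<Longrightarrow> p s \<ge> p t - D * (t - s)"
proof -
  define q where "q y = (p y - p t) / (y - t)" for y
  define D where "D = (INF y\<in>{t<..}. q y)"
  have mono: "q x \<le> q y" if "t < x" "x \<le> y" for x y
  proof (cases "x = y")
    case False
    with convex_on_slope_le(1)[OF assms, of t y x] that show ?thesis
      unfolding q_def by (simp add: field_split_simps)
  qed simp
  have left: "(p t - p s) / (t - s) \<le> q y" if "s < t" "t < y" for s y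
  proof -
    have "(p s - p t) / (s - t) = (p t - p s) / (t - s)" by (metis minus_diff_eq minus_divide_divide)
    moreover have "(p t - p y) / (t - y) = q y" unfolding q_def by (metis minus_diff_eq minus_divide_divide)
    ultimately show ?thesis
      using convex_on_slope_le[OF assms, of s y t] that by simp
  qed
  have bdd: "bdd_below (q ` {t<..})"
    using left[of "t - 1"] by (intro bdd_belowI2) auto
  have le: "D \<le> q y" if "t < y" for y unfolding D_def using bdd that by (intro cINF_lower) auto
  have lim: "(q \<longlongrightarrow> D) (at_right t)"
  proof (rule order_tendstoI)
    fix a assume "a < D"
    then show "\<forall>\<^sub>F y in at_right t. a < q y"
      using le by (smt (verit) eventually_at_right_less eventually_mono)
  next
    fix a assume "D < a"
    then obtain y where y: "y > t" "q y < a"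
      unfolding D_def using cINF_less_iff[OF _ bdd] by auto
    then show "\<forall>\<^sub>F y in at_right t. q y < a"
      unfolding eventually_at_right_field using mono by (metis le_less_trans less_imp_le)
  qed
  show thesis
  proof (rule that)
    show "(p has_real_derivative D) (at_right t)"
      using lim unfolding has_field_derivative_iff q_def by simp
    fix s assume "s \<le> t"
    show "p s \<ge> p t - D * (t - s)"
    proof (cases "s = t")
      case False
      then have "s < t" using \<open>s \<le> t\<close> by simp
      have "(p t - p s) / (t - s) \<le> D" unfolding D_def
        by (rule cINF_greatest) (use left[OF \<open>s < t\<close>] in auto)
      then show ?thesis using \<open>s < t\<close> by (simp add: field_simps)
    qed simp
  qed
qed

subsection \<open>Splitting off zeros\<close>

text \<open>On the circle of radius \<open>s\<close> every linear factor has modulus at least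
  \<open>s - \<rho>\<close>; the maximum principle for \<open>g\<close> carries the resulting bound
  into the disc.\<close>

lemma norm_cofactor_le:
  fixes a :: "nat \<Rightarrow> complex"
  assumes hol: "f holomorphic_on UNIV" "g holomorphic_on UNIV"
    and fac: "\<And>z. f z = (\<Prod>i<n. z - a i) * g z"
    and a: "\<And>i. i < n \<Longrightarrow> cmod (a i) \<le> \<rho>" and "0 \<le> \<rho>" "\<rho> < s" and z: "cmod z \<le> s"
  shows "cmod (g z) * (s - \<rho>) ^ n \<le> max_modulus f s"
proof -
  have "continuous_on (sphere 0 s) g" using hol(2) by (rule entire_continuous_on)
  then obtain w where w: "cmod w = s" "cmod (g w) = max_modulus g s"
    using max_modulus_attained \<open>0 \<le> \<rho>\<close> \<open>\<rho> < s\<close> by (metis less_le_trans less_imp_le order_trans)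
  have "(s - \<rho>) ^ n = (\<Prod>i<n. s - \<rho>)" by simp
  also have "\<dots> \<le> (\<Prod>i<n. cmod (w - a i))"
  proof (rule prod_mono)
    fix i assume "i \<in> {..<n}"
    with a[of i] w norm_triangle_ineq2[of w "a i"] \<open>\<rho> < s\<close>
    show "0 \<le> s - \<rho> \<and> s - \<rho> \<le> cmod (w - a i)" by auto
  qed
  also have "\<dots> = cmod (\<Prod>i<n. w - a i)" by (simp add: prod_norm)
  finally have P: "(s - \<rho>) ^ n \<le> cmod (\<Prod>i<n. w - a i)" .
  have "cmod (g z) \<le> cmod (g w)" using norm_le_max_modulus_disc[OF hol(2) z] w(2) by simp
  then have "cmod (g z) * (s - \<rho>) ^ n \<le> cmod (g w) * cmod (\<Prod>i<n. w - a i)"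
    using P \<open>\<rho> < s\<close> by (intro mult_mono) auto
  also have "\<dots> = cmod (f w)" by (simp add: fac norm_mult)
  also have "\<dots> \<le> max_modulus f s"
    using norm_le_max_modulus[OF entire_continuous_on[OF hol(1)] w(1)] .
  finally show ?thesis .
qed

lemma norm_linear_product_le:
  fixes a :: "nat \<Rightarrow> complex"
  assumes "\<And>i. i < n \<Longrightarrow> cmod (a i) \<le> \<rho>"
  shows "cmod (\<Prod>i<n. z - a i) \<le> (cmod z + \<rho>) ^ n"
proof -
  have "cmod (\<Prod>i<n. z - a i) = (\<Prod>i<n. cmod (z - a i))" by (simp add: prod_norm)
  also have "\<dots> \<le> (\<Prod>i<n. cmod z + \<rho>)"
  proof (rule prod_mono)
    fix i assume "i \<in> {..<n}"
    with assms[of i] norm_triangle_ineq4[of z "a i"]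
    show "0 \<le> cmod (z - a i) \<and> cmod (z - a i) \<le> cmod z + \<rho>" by auto
  qed
  finally show ?thesis by simp
qed

text \<open>The number of factors that can be split off is bounded because of the growth of \<open>f\<close>; with the
  maximal number the cofactor has no zeros left.\<close>

lemma factor_zeros_in_disc:
  assumes hol: "f holomorphic_on UNIV" and nc: "\<not> f constant_on UNIV" and \<rho>: "0 < \<rho>"
  obtains n :: nat and a :: "nat \<Rightarrow> complex" and g where
    "g holomorphic_on UNIV" "\<And>z. f z = (\<Prod>i<n. z - a i) * g z"
    "\<And>i. i < n \<Longrightarrow> cmod (a i) \<le> \<rho>" "\<And>z. cmod z \<le> \<rho> \<Longrightarrow> g z \<noteq> 0"
proof -
  define S where "S = {n :: nat. \<exists>a g. g holomorphic_on UNIV \<and> (\<forall>z. f z = (\<Prod>i<n. z - a i) * g z) \<and>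
    (\<forall>i<n. cmod (a i) \<le> \<rho>)}"
  obtain z1 where z1: "f z1 \<noteq> 0" using nc by (auto simp: constant_on_def)
  \<comment> \<open>With this radius \<open>s - \<rho>\<close> is twice the bound
    \<open>cmod z1 + \<rho>\<close> for a factor at \<open>z1\<close>, so every factor split off
    costs a power of 2.\<close>
  define s where "s = 2 * cmod z1 + 3 * \<rho>"
  have s: "cmod z1 \<le> s" "\<rho> < s" "s - \<rho> = 2 * (cmod z1 + \<rho>)"
    using \<rho> norm_ge_zero[of z1] unfolding s_def by argo+
  have "real n \<le> max_modulus f s / cmod (f z1)" if "n \<in> S" for n
  proof -
    from that obtain a g where "g holomorphic_on UNIV \<and> (\<forall>z. f z = (\<Prod>i<n. z - a i) * g z) \<and>
      (\<forall>i<n. cmod (a i) \<le> \<rho>)" unfolding S_def mem_Collect_eq by (elim exE)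
    then have g: "g holomorphic_on UNIV" and fac: "\<And>z. f z = (\<Prod>i<n. z - a i) * g z"
      and a: "\<And>i. i < n \<Longrightarrow> cmod (a i) \<le> \<rho>" by simp_all
    have "2 ^ n * cmod (f z1) \<le> 2 ^ n * ((cmod z1 + \<rho>) ^ n * cmod (g z1))"
      unfolding fac norm_mult using norm_linear_product_le[of n a \<rho> z1, OF a]
      by (intro mult_left_mono mult_right_mono) auto
    also have "\<dots> = cmod (g z1) * (s - \<rho>) ^ n" unfolding s(3) power_mult_distrib by simp
    also have "\<dots> \<le> max_modulus f s"
      by (rule norm_cofactor_le[OF hol g fac a less_imp_le[OF \<rho>] s(2) s(1)])
    finally have "2 ^ n \<le> max_modulus f s / cmod (f z1)" using z1 by (simp add: field_simps)
    moreover have "real n \<le> 2 ^ n" by (simp add: less_imp_le of_nat_less_two_power)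
    ultimately show ?thesis by linarith
  qed
  then have "\<forall>n\<in>S. n \<le> nat \<lceil>max_modulus f s / cmod (f z1)\<rceil>"
    using real_nat_ceiling_ge of_nat_le_iff order_trans by blast
  then have fin: "finite S" by (meson finite_nat_set_iff_bounded_le)
  have "0 \<in> S" using hol unfolding S_def by auto
  then have max: "Max S \<in> S" using fin Max_in by blast
  define n where "n = Max S"
  obtain a g where "g holomorphic_on UNIV \<and> (\<forall>z. f z = (\<Prod>i<n. z - a i) * g z) \<and>
    (\<forall>i<n. cmod (a i) \<le> \<rho>)"
    using max unfolding n_def[symmetric] unfolding S_def mem_Collect_eq by (elim exE)
  then have g: "g holomorphic_on UNIV" and fac: "\<And>z. f z = (\<Prod>i<n. z - a i) * g z"
    and a: "\<And>i. i < n \<Longrightarrow> cmod (a i) \<le> \<rho>" by simp_all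
  have "g b \<noteq> 0" if b: "cmod b \<le> \<rho>" for b
  proof
    assume gb: "g b = 0"
    \<comment> \<open>Dividing out the zero \<open>b\<close> would give \<open>Suc n\<close>
      factors, against the maximality of \<open>n\<close>.\<close>
    define h where "h = (\<lambda>z. if z = b then deriv g b else (g z - g b) / (z - b))"
    have "h holomorphic_on UNIV" unfolding h_def by (rule pole_lemma_open[OF g]) auto
    moreover have "g z = (z - b) * h z" for z using gb by (simp add: h_def)
    then have "f z = (\<Prod>i<Suc n. z - (a(n := b)) i) * h z" for z
      by (simp add: fac)
    moreover have "\<forall>i<Suc n. cmod ((a(n := b)) i) \<le> \<rho>" using a b by (auto simp: less_Suc_eq)
    ultimately have "Suc n \<in> S" unfolding S_def mem_Collect_eq
      by (intro exI[of _ "a(n := b)"] exI[of _ h]) simp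
    then show False using Max_ge[OF fin, of "Suc n"] by (simp add: n_def)
  qed
  with g fac a show thesis by (rule that)
qed

text \<open>Replacing the factors \<open>z - a\<close> with \<open>\<bar>a\<bar> < r\<close> by \<open>r - cnj a * z / r\<close> does not change the modulus
  on the circle of radius \<open>r\<close>, and the value of the new product at \<open>0\<close> is the bound sought.\<close>

lemma linear_product_large_on_circle:
  fixes a :: "nat \<Rightarrow> complex"
  assumes r: "0 < r"
  obtains z where "cmod z = r" "(\<Prod>i<n. max r (cmod (a i))) \<le> cmod (\<Prod>i<n. z - a i)"
proof -
  define Q where "Q z = (\<Prod>i<n. if cmod (a i) < r then of_real r - cnj (a i) * z / of_real r else z - a i)" for z
  have hol: "Q holomorphic_on UNIV" unfolding Q_def
  proof (intro holomorphic_on_prod)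
    show "(\<lambda>z. if cmod (a i) < r then of_real r - cnj (a i) * z / of_real r else z - a i) holomorphic_on UNIV" for i
      by (cases "cmod (a i) < r") (use r in \<open>auto intro!: holomorphic_intros\<close>)
  qed
  obtain z where z: "cmod z = r" "cmod (Q z) = max_modulus Q r"
    using max_modulus_attained[OF entire_continuous_on[OF hol]] r by (metis less_imp_le)
  have "cmod (of_real r - cnj b * z / of_real r) = cmod (z - b)" for b
  proof -
    have "of_real r * of_real r = z * cnj z" using z(1) by (metis complex_norm_square power2_eq_square of_real_mult)
    then have "of_real r - cnj b * z / of_real r = z * cnj (z - b) / of_real r"
      using r by (simp add: field_simps)
    then show ?thesis using z(1) r by (simp add: norm_mult norm_divide flip: complex_cnj_diff)
  qed
  then have "cmod (Q z) = cmod (\<Prod>i<n. z - a i)"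
    unfolding Q_def prod_norm[symmetric] by (intro prod.cong) auto
  moreover have "cmod (Q 0) = (\<Prod>i<n. max r (cmod (a i)))"
    unfolding Q_def prod_norm[symmetric] using r by (intro prod.cong) auto
  moreover have "cmod (Q 0) \<le> max_modulus Q r" using norm_le_max_modulus_disc[OF hol, of 0 r] r by simp
  ultimately show thesis using that z by simp
qed

text \<open>The map taking \<open>u\<close> to \<open>u / (2 * A - u)\<close> sends the half-plane
  \<open>Re u < A\<close> into the unit disc and fixes 0, so the Schwarz lemma applies to
  \<open>F\<close>.\<close>

lemma Borel_Caratheodory:
  assumes hol: "h holomorphic_on ball 0 \<rho>" and B: "\<And>z. cmod z < \<rho> \<Longrightarrow> Re (h z) < B"
    and \<rho>: "0 < \<rho>" and q: "0 \<le> q" "q < 1" and z: "cmod z \<le> q * \<rho>"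
  shows "cmod (h z - h 0) \<le> 2 * q / (1 - q) * (B - Re (h 0))"
proof -
  define A where "A = B - Re (h 0)"
  have A: "A > 0" using B[of 0] \<rho> by (simp add: A_def)
  define k where "k w = h (of_real \<rho> * w) - h 0" for w :: complex
  define F where "F w = k w / (2 * of_real A - k w)" for w
  have kRe: "Re (k w) < A" if "cmod w < 1" for w
    using B[of "of_real \<rho> * w"] \<rho> that by (simp add: k_def A_def norm_mult)
  have nz: "2 * of_real A - k w \<noteq> 0" if "cmod w < 1" for w
    using kRe[OF that] A by (auto simp: complex_eq_iff)
  have "k holomorphic_on ball 0 1" unfolding k_def
    by (intro holomorphic_intros holomorphic_on_compose_gen[OF _ hol, unfolded o_def])
      (use \<rho> in \<open>auto simp: norm_mult\<close>)
  then have Fhol: "F holomorphic_on ball 0 1" unfolding F_def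
    using nz by (intro holomorphic_intros) auto
  have F1: "cmod (F w) < 1" if "cmod w < 1" for w
  proof -
    have "(Re (k w))\<^sup>2 < (2 * A - Re (k w))\<^sup>2"
    proof -
      have "(2 * A - Re (k w))\<^sup>2 - (Re (k w))\<^sup>2 = 4 * A * (A - Re (k w))"
        by (simp add: power2_eq_square algebra_simps)
      also have "\<dots> > 0" using A kRe[OF that] by simp
      finally show ?thesis by simp
    qed
    then have "cmod (k w) < cmod (2 * of_real A - k w)"
      unfolding cmod_def by (intro real_sqrt_less_mono) simp
    then show ?thesis using nz[OF that] by (simp add: F_def norm_divide divide_less_eq)
  qed
  have F0: "F 0 = 0" by (simp add: F_def k_def)
  define w where "w = z / \<rho>"
  have w: "cmod w \<le> q" using z \<rho> by (simp add: w_def norm_divide field_simps)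
  then have w1: "cmod w < 1" using q by linarith
  have "cmod (F w) \<le> q"
    using Schwarz_Lemma(1)[OF Fhol F0 F1 w1] w by linarith
  then have "cmod (k w) \<le> q * cmod (2 * of_real A - k w)"
    using nz[OF w1] by (simp add: F_def norm_divide field_simps)
  also have "\<dots> \<le> q * (2 * A + cmod (k w))"
    using norm_triangle_ineq4[of "2 * of_real A" "k w"] A q by (intro mult_left_mono) (auto simp: norm_mult)
  finally have "cmod (k w) * (1 - q) \<le> 2 * q * A" by (simp add: algebra_simps)
  then have "cmod (k w) \<le> 2 * q / (1 - q) * A" using q by (simp add: field_simps)
  then show ?thesis using \<rho> by (simp add: k_def w_def A_def)
qed

text \<open>A holomorphic logarithm \<open>h\<close> of \<open>g\<close> has real part below
  \<open>B\<close>. One use of Borel--Caratheodory moves the lower bound from \<open>z0\<close> to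
  0, a second one bounds the oscillation on the smaller disc.\<close>

lemma ln_norm_zero_free_almost_constant:
  assumes hol: "g holomorphic_on ball 0 \<rho>" and nz: "\<And>z. cmod z < \<rho> \<Longrightarrow> g z \<noteq> 0"
    and B: "\<And>z. cmod z < \<rho> \<Longrightarrow> ln (cmod (g z)) < B"
    and \<rho>: "0 < \<rho>" and z0: "cmod z0 \<le> \<rho> / 5" "B - ln (cmod (g z0)) \<le> V"
    and q: "0 \<le> q" "q \<le> 1 / 2" and z: "cmod z \<le> q * \<rho>"
  shows "\<bar>ln (cmod (g z)) - ln (cmod (g 0))\<bar> \<le> 8 * q * V"
proof -
  obtain h where h: "h holomorphic_on ball 0 \<rho>" "\<And>z. z \<in> ball 0 \<rho> \<Longrightarrow> g z = exp (h z)"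
    using contractible_imp_holomorphic_log[OF hol] nz
    by (metis convex_imp_contractible convex_ball mem_ball_0)
  have ln: "ln (cmod (g z)) = Re (h z)" if "cmod z < \<rho>" for z
    using h(2)[of z] that by simp
  have Bh: "Re (h z) < B" if "cmod z < \<rho>" for z using B ln that by simp
  have z0': "cmod z0 \<le> 1/5 * \<rho>" "cmod z0 < \<rho>" using z0 \<rho> by auto
  \<comment> \<open>At \<open>q = 1/5\<close> the constant \<open>2 * q / (1 - q)\<close> is
    \<open>1/2\<close>: half of the gap \<open>B - Re (h 0)\<close> is absorbed, and the rest is
    controlled by \<open>V\<close>.\<close>
  have "cmod (h z0 - h 0) \<le> 2 * (1/5) / (1 - 1/5) * (B - Re (h 0))"
    using Borel_Caratheodory[OF h(1) Bh \<rho> _ _ z0'(1)] by simp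
  then have "cmod (h z0 - h 0) \<le> 1/2 * (B - Re (h 0))" by simp
  moreover have "Re (h z0) \<le> Re (h 0) + cmod (h z0 - h 0)"
    using complex_Re_le_cmod[of "h z0 - h 0"] by simp
  ultimately have v0: "B - Re (h 0) \<le> 2 * V" using z0(2) ln[OF z0'(2)] by simp
  have pos: "0 < B - Re (h 0)" using Bh[of 0] \<rho> by simp
  have zr: "cmod z < \<rho>"
    using z q \<rho> mult_right_mono[of q "1/2" \<rho>] by linarith
  have "\<bar>Re (h z) - Re (h 0)\<bar> \<le> cmod (h z - h 0)"
    using abs_Re_le_cmod[of "h z - h 0"] by simp
  also have "\<dots> \<le> 2 * q / (1 - q) * (B - Re (h 0))"
    by (rule Borel_Caratheodory[OF h(1) Bh \<rho> _ _ z]) (use q in auto)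
  also have "\<dots> \<le> 4 * q * (2 * V)"
  proof (rule mult_mono)
    have "q / (1 - q) \<le> 2 * q" using q mult_left_mono[of q "1/2" q] by (simp add: field_simps)
    then show "2 * q / (1 - q) \<le> 4 * q" by simp
  qed (use v0 pos q in auto)
  finally show ?thesis using ln[OF zr] ln[of 0] \<rho> by simp
qed

subsection \<open>Circles of large minimum modulus\<close>

text \<open>Needed for an antiderivative of \<open>ln \<bar>x - y\<bar>\<close> that is continuous
  across the singularity.\<close>

lemma continuous_on_times_ln_abs: "continuous_on S (\<lambda>u::real. u * ln \<bar>u\<bar>)"
proof -
  have "isCont (\<lambda>u::real. u * ln \<bar>u\<bar>) u" for u
  proof (cases "u = 0")
    case True
    have "((\<lambda>u::real. u * ln \<bar>u\<bar>) \<longlongrightarrow> 0) (at_left 0)" by real_asymp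
    moreover have "((\<lambda>u::real. u * ln \<bar>u\<bar>) \<longlongrightarrow> 0) (at_right 0)" by real_asymp
    ultimately show ?thesis using True by (simp add: isCont_def filterlim_split_at)
  qed (auto intro!: continuous_intros)
  then show ?thesis by (simp add: continuous_at_imp_continuous_on)
qed

text \<open>The fundamental theorem of calculus allows the single exceptional point
  \<open>y\<close>, since the antiderivative \<open>F\<close> is continuous there. What matters is
  that the bound is uniform in \<open>y\<close>.\<close>

lemma has_integral_neg_ln_abs:
  fixes y :: real
  obtains c where "((\<lambda>x. - ln \<bar>x - y\<bar>) has_integral c) {0..1}" "c \<le> 2"
proof -
  define F where "F x = (x - y) - (x - y) * ln \<bar>x - y\<bar>" for x
  have "continuous_on {0..1} F" unfolding F_def
    by (intro continuous_intros continuous_on_compose2[OF continuous_on_times_ln_abs[of UNIV]]) auto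
  moreover have "(F has_vector_derivative - ln \<bar>x - y\<bar>) (at x)" if "x \<noteq> y" for x
  proof (cases "x > y")
    case True
    have "((\<lambda>x. (x - y) - (x - y) * ln (x - y)) has_field_derivative - ln (x - y)) (at x)"
      using True by (auto intro!: derivative_eq_intros)
    moreover have "\<forall>\<^sub>F u in nhds x. F u = (u - y) - (u - y) * ln (u - y)"
      using eventually_gt_at_top eventually_nhds_in_open[OF open_greaterThan, of x y] True
      by (auto simp: F_def elim!: eventually_mono)
    ultimately show ?thesis using True
      by (simp add: DERIV_cong_ev has_real_derivative_iff_has_vector_derivative[symmetric])
  next
    case False
    have "((\<lambda>x. (x - y) - (x - y) * ln (y - x)) has_field_derivative - ln (y - x)) (at x)"
    proof -
      have "(x - y) * (- 1 / (y - x)) = 1" using that by (simp add: field_simps)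
      then show ?thesis using False that by (auto intro!: derivative_eq_intros)
    qed
    moreover have "\<forall>\<^sub>F u in nhds x. F u = (u - y) - (u - y) * ln (y - u)"
      using eventually_nhds_in_open[OF open_lessThan, of x y] False that
      by (auto simp: F_def elim!: eventually_mono)
    ultimately show ?thesis using False
      by (simp add: DERIV_cong_ev has_real_derivative_iff_has_vector_derivative[symmetric])
  qed
  ultimately have int: "((\<lambda>x. - ln \<bar>x - y\<bar>) has_integral (F 1 - F 0)) {0..1}"
    by (intro fundamental_theorem_of_calculus_interior_strong[of "{y}"]) auto
  \<comment> \<open>\<open>aux\<close> serves for \<open>y\<close> outside the unit interval,
    \<open>aux2\<close> for \<open>y\<close> inside it.\<close>
  have aux: "u * ln u \<le> (1 + u) * ln (1 + u)" if "0 < u" for u :: real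
  proof -
    have "u * ln u \<le> u * ln (1 + u)" using that by (intro mult_left_mono) auto
    also have "\<dots> \<le> (1 + u) * ln (1 + u)" using that by (intro mult_right_mono) auto
    finally show ?thesis .
  qed
  have aux2: "- (u * ln u) \<le> 1 - u" if "0 \<le> u" for u :: real
  proof (cases "u = 0")
    case False
    then have "ln (1 / u) \<le> 1 / u - 1" using that by (intro ln_le_minus_one) auto
    then have "u * (- ln u) \<le> u * (1 / u - 1)" using that False
      by (intro mult_left_mono) (auto simp: ln_div)
    then show ?thesis using False by (simp add: algebra_simps)
  qed simp
  have "F 1 - F 0 = 1 - (1 - y) * ln \<bar>1 - y\<bar> - y * ln \<bar>y\<bar>" by (simp add: F_def)
  also have "\<dots> \<le> 2"
  proof -
    consider "y < 0" | "0 \<le> y" "y \<le> 1" | "y > 1" by linarith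
    then show ?thesis
    proof cases
      case 1 then show ?thesis using aux[of "-y"] by simp
    next
      case 2 then show ?thesis using aux2[of y] aux2[of "1 - y"] by simp
    next
      case 3 then show ?thesis using aux[of "y - 1"] by (simp add: algebra_simps)
    qed
  qed
  finally show thesis using that int by blast
qed

text \<open>The mean of the sum over the unit interval is at most \<open>2 * card I\<close>, so it
  cannot exceed \<open>3 * card I\<close> at almost every point.\<close>

lemma exists_point_far_from_all:
  fixes y :: "'i \<Rightarrow> real"
  assumes fin: "finite I"
  obtains x where "0 \<le> x" "x \<le> 1" "\<And>i. i \<in> I \<Longrightarrow> x \<noteq> y i"
    "(\<Sum>i\<in>I. - ln \<bar>x - y i\<bar>) \<le> 3 * real (card I)"
proof (cases "I = {}")
  case True
  then show thesis using that[of 0] by simp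
next
  case False
  have "\<exists>x\<in>{0..1}. x \<notin> y ` I \<and> (\<Sum>i\<in>I. - ln \<bar>x - y i\<bar>) \<le> 3 * real (card I)"
  proof (rule ccontr)
    assume neg: "\<not> ?thesis"
    have "\<forall>i. \<exists>c. ((\<lambda>x. - ln \<bar>x - y i\<bar>) has_integral c) {0..1} \<and> c \<le> 2"
      using has_integral_neg_ln_abs by metis
    then obtain c where c: "\<And>i. ((\<lambda>x. - ln \<bar>x - y i\<bar>) has_integral c i) {0..1}" "\<And>i. c i \<le> 2"
      by metis
    \<comment> \<open>At the points \<open>y i\<close> the convention \<open>ln 0 = 0\<close> makes
      the sum uninformative. Its value there is replaced, which leaves the integral unchanged and
      forces the point found to avoid them.\<close>
    define g where "g x = (if x \<in> y ` I then 3 * real (card I) else \<Sum>i\<in>I. - ln \<bar>x - y i\<bar>)" for x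
    have "((\<lambda>x. \<Sum>i\<in>I. - ln \<bar>x - y i\<bar>) has_integral (\<Sum>i\<in>I. c i)) {0..1}"
      by (intro has_integral_sum fin c)
    then have g: "(g has_integral (\<Sum>i\<in>I. c i)) {0..1}"
      by (rule has_integral_spike_finite[of "y ` I", rotated 2]) (auto simp: g_def fin)
    have "((\<lambda>x. 3 * real (card I)) has_integral 3 * real (card I)) {0..1::real}"
      using has_integral_const_real[of "3 * real (card I)" 0 1] by simp
    from this g have "3 * real (card I) \<le> sum c I"
      by (rule has_integral_le) (use neg in \<open>force simp: g_def\<close>)
    also have "\<dots> \<le> (\<Sum>i\<in>I. 2)" by (intro sum_mono c)
    finally show False using fin False by (simp add: card_gt_0_iff)
  qed
  then show thesis using that by force
qed

text \<open>Bounds the loss caused by a zero whose modulus is far, by a factor of at least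
  \<open>1 / d\<close>, from the radius of the circle.\<close>

lemma ln_ratio_le:
  fixes u v d :: real
  assumes "0 \<le> u" "0 < v" "u \<le> d * v" "d \<le> 1 / 2"
  shows "ln ((v + u) / (v - u)) \<le> 4 * d"
proof -
  have "u \<le> v / 2" using assms mult_right_mono[of d "1/2" v] by linarith
  then have "(v + u) / (v - u) = 1 + 2 * u / (v - u)" "v - u \<ge> v / 2" using assms by (simp_all add: field_simps)
  moreover have "2 * u / (v - u) \<le> 2 * u / (v / 2)"
    using assms \<open>u \<le> v / 2\<close> by (intro divide_left_mono) auto
  moreover have "2 * u / (v / 2) \<le> 4 * d" using assms by (simp add: field_simps)
  moreover have "ln (1 + 2 * u / (v - u)) \<le> 2 * u / (v - u)"
    using assms \<open>u \<le> v / 2\<close> by (intro ln_add_one_self_le_self) auto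
  ultimately show ?thesis by simp
qed

lemma ln_prod_times:
  fixes h :: "'i \<Rightarrow> real"
  assumes "finite A" "\<And>i. i \<in> A \<Longrightarrow> 0 < h i" "0 < c"
  shows "ln ((\<Prod>i\<in>A. h i) * c) = (\<Sum>i\<in>A. ln (h i)) + ln c"
proof -
  have "ln (\<Prod>i\<in>A. h i) = (\<Sum>i\<in>A. ln (h i))" using assms(1,2) by (intro ln_prod) (metis less_irrefl)+
  moreover have "0 < (\<Prod>i\<in>A. h i)" using assms(2) by (intro prod_pos)
  ultimately show ?thesis using assms(3) by (simp add: ln_mult)
qed

text \<open>As a function of \<open>x\<close>, \<open>ln (max (exp x) u)\<close> is constant until
  \<open>exp x\<close> reaches \<open>u\<close> and has slope 1 afterwards. Summed over the zeros,
  its increments therefore count zeros.\<close>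

lemma ln_max_increment:
  fixes x y u :: real
  assumes "x \<le> y"
  shows "(if u \<le> exp x then y - x else 0) \<le> ln (max (exp y) u) - ln (max (exp x) u)"
    and "ln (max (exp y) u) - ln (max (exp x) u) \<le> (if u < exp y then y - x else 0)"
proof -
  have xy: "exp x \<le> exp y" using assms by simp
  consider "u \<le> exp x" | "exp x < u" "u < exp y" | "exp x < u" "exp y \<le> u" by linarith
  then have "(if u \<le> exp x then y - x else 0) \<le> ln (max (exp y) u) - ln (max (exp x) u) \<and>
    ln (max (exp y) u) - ln (max (exp x) u) \<le> (if u < exp y then y - x else 0)"
  proof cases
    case 1
    then have "max (exp y) u = exp y" "max (exp x) u = exp x"
      using xy by (metis max_absorb1 order_trans)+
    moreover have "u < exp y" if "x \<noteq> y"
      using 1 that assms exp_less_mono[of x y] by linarith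
    ultimately show ?thesis using 1 assms by auto
  next
    case 2
    then have "0 < u" using exp_gt_zero[of x] by linarith
    then have "x \<le> ln u" "ln u \<le> y" using 2 ln_mono[of "exp x" u] ln_mono[of u "exp y"] by auto
    then show ?thesis using 2 by (auto simp: max_def)
  next
    case 3
    then show ?thesis using xy by (auto simp: max_def)
  qed
  then show "(if u \<le> exp x then y - x else 0) \<le> ln (max (exp y) u) - ln (max (exp x) u)"
    and "ln (max (exp y) u) - ln (max (exp x) u) \<le> (if u < exp y then y - x else 0)" by auto
qed

text \<open>The permitted loss \<open>N\<close> is spent as follows: \<open>N / 5\<close> twice for
  the oscillation of the zero-free cofactor, and at most \<open>N / 2\<close> for the linear
  factors.\<close>

lemma large_min_modulus_on_circle:
  fixes N t :: real
  assumes hol: "f holomorphic_on UNIV" and nc: "\<not> f constant_on UNIV" and N: "0 < N" and t: "100000 \<le> t"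
    and p: "\<And>x. 0 \<le> x \<Longrightarrow> x \<le> t \<Longrightarrow> \<bar>log_max_modulus f x - N * x\<bar> \<le> N * t / 10000"
  obtains s where "t / 2 \<le> s" "s \<le> t / 2 + 1"
    "\<And>z. cmod z = exp s \<Longrightarrow> exp (log_max_modulus f s - N) \<le> cmod (f z)"
proof -
  let ?p = "log_max_modulus f"
  have pU: "?p x \<le> N * x + N * t / 10000" and pL: "N * x - N * t / 10000 \<le> ?p x" if "0 \<le> x" "x \<le> t" for x
    using p[OF that] by linarith+
  have ln2: "0 < ln (2::real)" "ln (2::real) \<le> 1" using ln_le_minus_one[of 2] by auto
  have exp8: "exp (- t / 8) * t \<le> 1 / 100"
  proof -
    have "t * 100 \<le> 1 + t/8 + (t/8)\<^sup>2 / 2"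
    proof -
      have "t * 100000 \<le> t * t" using t by (intro mult_left_mono) auto
      moreover have "(t/8)\<^sup>2 / 2 = t * t / 128" by (simp add: power2_eq_square)
      ultimately show ?thesis using t by linarith
    qed
    also have "\<dots> \<le> exp (t / 8)" using exp_lower_Taylor_quadratic[of "t/8"] t by simp
    finally show ?thesis by (simp add: exp_minus field_simps)
  qed
  have exp16: "exp (- t / 16) \<le> 1 / 5000"
    using exp_ge_add_one_self[of "t/16"] t by (simp add: exp_minus field_simps)
  have M: "max_modulus f (exp x) = exp (?p x)" for x
    using max_modulus_pos[OF hol nc, of "exp x"] by (simp add: log_max_modulus_def)

  \<comment> \<open>Splitting off the zeros and bounding their number\<close>
  define \<rho> where "\<rho> = exp (3 * t / 4)"
  have \<rho>: "0 < \<rho>" by (simp add: \<rho>_def)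
  obtain n :: nat and a g where g: "g holomorphic_on UNIV" and fac: "\<And>z. f z = (\<Prod>i<n. z - a i) * g z"
    and a: "\<And>i. i < n \<Longrightarrow> cmod (a i) \<le> \<rho>" and gnz: "\<And>z. cmod z \<le> \<rho> \<Longrightarrow> g z \<noteq> 0"
    using factor_zeros_in_disc[OF hol nc \<rho>] by metis
  have top: "\<exists>z. cmod z = exp x \<and> cmod (f z) = exp (?p x)" for x
    using max_modulus_attained[OF entire_continuous_on[OF hol], of "exp x"] M by (metis exp_ge_zero)

  \<comment> \<open>\<open>n * L1\<close> bounds the logarithm of the polynomial factor from below
    on the circle of radius \<open>exp t\<close>, \<open>n * L2\<close> from above on the unit
    circle. As \<open>L1 - L2\<close> is at least \<open>t / 5\<close>, the growth of
    \<open>?p\<close> bounds \<open>n\<close>.\<close>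
  define L1 L2 where "L1 = ln (exp t - \<rho>)" and "L2 = ln (1 + \<rho>)"
  have e4: "exp (t / 4) \<ge> 2" using exp_ge_add_one_self[of "t/4"] t by linarith
  have "exp t = \<rho> * exp (t/4)" by (simp add: \<rho>_def flip: exp_add)
  then have "exp t \<ge> 2 * \<rho>" using e4 \<rho> by (simp add: mult.commute)
  then have gap: "\<rho> < exp t" "exp t / 2 \<le> exp t - \<rho>" using \<rho> by auto
  have "ln (exp t / 2) \<le> L1" unfolding L1_def using gap \<rho> by (intro ln_mono) auto
  then have L1: "t - ln 2 \<le> L1" by (simp add: ln_div)
  have "1 \<le> \<rho>" using t by (simp add: \<rho>_def)
  then have "L2 \<le> ln (2 * \<rho>)" unfolding L2_def by (intro ln_mono) auto
  then have L2: "L2 \<le> 3 * t / 4 + ln 2" by (simp add: ln_mult \<rho>_def)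
  obtain z0 where z0: "cmod z0 = 1" "cmod (f z0) = exp (?p 0)" using top[of 0] by auto
  have gz0: "g z0 \<noteq> 0" using gnz z0 \<open>1 \<le> \<rho>\<close> by simp
  have "exp (?p 0) \<le> (1 + \<rho>) ^ n * cmod (g z0)"
    unfolding z0(2)[symmetric] fac norm_mult
    using norm_linear_product_le[of n a \<rho> z0, OF a] z0(1) by (intro mult_right_mono) auto
  then have "?p 0 \<le> ln ((1 + \<rho>) ^ n * cmod (g z0))"
    using \<rho> gz0 by (subst ln_ge_iff) auto
  then have p0: "?p 0 \<le> n * L2 + ln (cmod (g z0))"
    using \<rho> gz0 by (simp add: ln_mult ln_realpow L2_def)
  have glog: "ln (cmod (g z)) \<le> ?p t - n * L1" if "cmod z \<le> \<rho>" for z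
  proof -
    have "cmod (g z) * (exp t - \<rho>) ^ n \<le> exp (?p t)"
      unfolding M[symmetric] by (rule norm_cofactor_le[OF hol g fac a]) (use \<rho> gap that in auto)
    moreover have "0 < cmod (g z) * (exp t - \<rho>) ^ n" using gnz[OF that] gap by simp
    ultimately have "ln (cmod (g z) * (exp t - \<rho>) ^ n) \<le> ?p t"
      by (metis ln_exp ln_mono)
    then show ?thesis using gnz[OF that] gap by (simp add: ln_mult ln_realpow L1_def)
  qed
  have pt: "?p t - ?p 0 < 2 * N * t"
  proof -
    have "?p t \<le> N * t + N * t / 10000" using pU[of t] t by simp
    moreover have "- (N * t / 10000) \<le> ?p 0" using pL[of 0] t by simp
    moreover have "0 < N * t" using N t by simp
    ultimately show ?thesis by linarith
  qed
  have n: "real n \<le> 11 * N"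
  proof -
    have "n * (t / 5) \<le> n * (L1 - L2)" using L1 L2 ln2 t by (intro mult_left_mono) auto
    also have "\<dots> \<le> ?p t - ?p 0" using p0 glog[of z0] z0(1) \<open>1 \<le> \<rho>\<close> by (simp add: algebra_simps)
    also have "\<dots> < 2 * N * t" by (rule pt)
    finally have "real n * t \<le> 10 * N * t" by simp
    then have "real n \<le> 10 * N" using t by simp
    then show ?thesis using N by linarith
  qed

  \<comment> \<open>Oscillation of the zero-free cofactor\<close>
  define \<gamma> where "\<gamma> = ln (cmod (g 0))"
  have gosc: "\<bar>ln (cmod (g z)) - \<gamma>\<bar> \<le> N / 5" if "cmod z \<le> exp (5 * t / 8)" for z
  proof -
    have "\<bar>ln (cmod (g z)) - ln (cmod (g 0))\<bar> \<le> 8 * exp (- t / 8) * (2 * N * t)"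
    \<comment> \<open>Here \<open>q = exp (- t / 8)\<close> is the ratio of the radii
      \<open>exp (5 * t / 8)\<close> and \<open>\<rho>\<close>, and \<open>V = 2 * N * t\<close>
      comes from the growth of \<open>?p\<close>; the exponential outweighs the factor
      \<open>t\<close>.\<close>
    proof (rule ln_norm_zero_free_almost_constant[of g \<rho> "ln (cmod (g z0)) + 2 * N * t" z0])
      show "g holomorphic_on ball 0 \<rho>" using g holomorphic_on_subset by blast
      show "g z \<noteq> 0" if "cmod z < \<rho>" for z using gnz that by simp
      show "ln (cmod (g z)) < ln (cmod (g z0)) + 2 * N * t" if "cmod z < \<rho>" for z
      proof -
        have "n * L2 \<le> n * L1" using L1 L2 ln2 t by (intro mult_left_mono) auto
        then show ?thesis using glog[of z] that p0 pt by simp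
      qed
      have "5 \<le> \<rho>" using exp_ge_add_one_self[of "3*t/4"] t unfolding \<rho>_def by linarith
      then show "cmod z0 \<le> \<rho> / 5" by (simp add: z0)
      have "exp (- t / 8) * 2 \<le> exp (- t / 8) * t" using t by (intro mult_left_mono) auto
      then show "exp (- t / 8) \<le> 1 / 2" using exp8 by linarith
      show "cmod z \<le> exp (- t / 8) * \<rho>" using that by (simp add: \<rho>_def flip: exp_add)
    qed (use \<rho> in auto)
    also have "\<dots> = 16 * N * (exp (- t / 8) * t)" by simp
    also have "\<dots> \<le> 16 * N * (1 / 100)" using exp8 N by (intro mult_left_mono) auto
    finally show ?thesis using N by (simp add: \<gamma>_def)
  qed

  have gU: "ln (cmod (g z)) \<le> \<gamma> + N / 5" and gL: "\<gamma> - N / 5 \<le> ln (cmod (g z))"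
    if "cmod z \<le> exp (5 * t / 8)" for z
    using gosc[OF that] by linarith+

  text \<open>By Jensen's formula \<open>J x\<close> is the mean over the circle of radius \<open>exp x\<close> of the logarithm of the
    polynomial factor. It differs from the maximum by at most \<open>n * ln 2\<close>, and its slope counts zeros;
    as \<open>?p\<close> is nearly linear, few zeros have modulus of the order of \<open>exp (t / 2)\<close>.\<close>

  define J where "J x = (\<Sum>i<n. ln (max (exp x) (cmod (a i))))" for x
  have exp_le_\<rho>: "exp x \<le> \<rho>" if "x \<le> 5 * t / 8" for x using that t by (simp add: \<rho>_def)
  have JU: "?p x \<le> \<gamma> + N / 5 + J x + n * ln 2" if x: "0 \<le> x" "x \<le> 5 * t / 8" for x
  proof -
    obtain z where z: "cmod z = exp x" "cmod (f z) = exp (?p x)" using top by blast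
    then have fz: "f z \<noteq> 0" by auto
    then have Pz: "(\<Prod>i<n. z - a i) \<noteq> 0" and gz: "g z \<noteq> 0" using fac by auto
    then have nz: "z - a i \<noteq> 0" if "i < n" for i using that by auto
    have "?p x = ln (cmod (f z))" using z by simp
    also have "\<dots> = (\<Sum>i<n. ln (cmod (z - a i))) + ln (cmod (g z))"
      unfolding fac norm_mult prod_norm[symmetric] using nz gz by (intro ln_prod_times) auto
    also have "(\<Sum>i<n. ln (cmod (z - a i))) \<le> (\<Sum>i<n. ln 2 + ln (max (exp x) (cmod (a i))))"
    proof (rule sum_mono)
      fix i assume "i \<in> {..<n}"
      then have "0 < cmod (z - a i)" using nz by simp
      moreover have "cmod (z - a i) \<le> 2 * max (exp x) (cmod (a i))"
        using norm_triangle_ineq4[of z "a i"] z by simp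
      ultimately have "ln (cmod (z - a i)) \<le> ln (2 * max (exp x) (cmod (a i)))" by (intro ln_mono) auto
      also have "\<dots> = ln 2 + ln (max (exp x) (cmod (a i)))"
      proof -
        have "0 < max (exp x) (cmod (a i))" by (simp add: less_max_iff_disj)
        then show ?thesis by (simp add: ln_mult)
      qed
      finally show "ln (cmod (z - a i)) \<le> ln 2 + ln (max (exp x) (cmod (a i)))" .
    qed
    also have "\<dots> = J x + n * ln 2" by (simp add: J_def sum.distrib)
    finally show ?thesis using gU[of z] z x by simp
  qed
  have JL: "J x \<le> ?p x - \<gamma> + N / 5" if x: "0 \<le> x" "x \<le> 5 * t / 8" for x
  proof -
    obtain z where z: "cmod z = exp x" "(\<Prod>i<n. max (exp x) (cmod (a i))) \<le> cmod (\<Prod>i<n. z - a i)"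
      using linear_product_large_on_circle[of "exp x" a n] by auto
    have gz: "0 < cmod (g z)" using gnz[of z] z exp_le_\<rho> x by simp
    have pos: "0 < (\<Prod>i<n. max (exp x) (cmod (a i)))" by (intro prod_pos) (auto simp: less_max_iff_disj)
    have "(\<Prod>i<n. max (exp x) (cmod (a i))) * cmod (g z) \<le> cmod (f z)"
      unfolding fac norm_mult using z by (intro mult_right_mono) auto
    also have "\<dots> \<le> exp (?p x)"
      using norm_le_max_modulus[OF entire_continuous_on[OF hol] z(1)] M by simp
    finally have "ln ((\<Prod>i<n. max (exp x) (cmod (a i))) * cmod (g z)) \<le> ?p x"
      using pos gz by (metis ln_exp ln_mono mult_pos_pos)
    then have "J x + ln (cmod (g z)) \<le> ?p x"
      using gz by (subst (asm) ln_prod_times) (auto simp: J_def less_max_iff_disj)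
    then show ?thesis using gL[of z] z x by simp
  qed
  have Jcount: "(y - x) * real (card {i. i < n \<and> cmod (a i) \<le> exp x}) \<le> J y - J x"
    "J y - J x \<le> (y - x) * real (card {i. i < n \<and> cmod (a i) < exp y})" if "x \<le> y" for x y
  proof -
    have D: "J y - J x = (\<Sum>i<n. ln (max (exp y) (cmod (a i))) - ln (max (exp x) (cmod (a i))))"
      by (simp add: J_def sum_subtractf)
    have c: "(y - x) * real (card {i. i < n \<and> P i}) = (\<Sum>i<n. if P i then y - x else 0)" for P
    proof -
      have "{i. i < n \<and> P i} = {i\<in>{..<n}. P i}" by auto
      then show ?thesis by (simp add: sum.If_cases Int_def)
    qed
    show "(y - x) * real (card {i. i < n \<and> cmod (a i) \<le> exp x}) \<le> J y - J x"
      unfolding D c by (intro sum_mono ln_max_increment that)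
    show "J y - J x \<le> (y - x) * real (card {i. i < n \<and> cmod (a i) < exp y})"
      unfolding D c by (intro sum_mono ln_max_increment that)
  qed

  \<comment> \<open>Few zeros in the middle annulus\<close>
  define mid where "mid = {i. i < n \<and> exp (7 * t / 16) \<le> cmod (a i) \<and> cmod (a i) \<le> exp (9 * t / 16)}"
  have fmid: "finite mid" by (simp add: mid_def)
  have mid: "real (card mid) \<le> N / 50"
  proof -
    define m1 m3 where "m1 = real (card {i. i < n \<and> cmod (a i) < exp (7 * t / 16)})"
      and "m3 = real (card {i. i < n \<and> cmod (a i) \<le> exp (9 * t / 16)})"
    have "{i. i < n \<and> cmod (a i) \<le> exp (9 * t / 16)} = {i. i < n \<and> cmod (a i) < exp (7 * t / 16)} \<union> mid"
    proof -
      have "exp (7 * t / 16) \<le> exp (9 * t / 16)" using t by simp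
      then have "cmod (a i) \<le> exp (9 * t / 16)" if "cmod (a i) < exp (7 * t / 16)" for i
        using that by linarith
      then show ?thesis by (auto simp: mid_def)
    qed
    then have card: "m3 = m1 + card mid" unfolding m1_def m3_def
      by (simp add: card_Un_disjoint fmid mid_def disjoint_iff)
    \<comment> \<open>The slope of \<open>J\<close> on the interval to the left of the annulus
      bounds \<open>m1\<close> from below, the slope to the right bounds \<open>m3\<close> from
      above. Both slopes are close to \<open>N\<close>.\<close>
    have e1: "J (7 * t / 16) - J (6 * t / 16) \<le> t / 16 * m1"
      using Jcount(2)[of "6*t/16" "7*t/16"] t by (simp add: m1_def)
    have e3: "t / 16 * m3 \<le> J (10 * t / 16) - J (9 * t / 16)"
      using Jcount(1)[of "9*t/16" "10*t/16"] t by (simp add: m3_def)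
    have b1: "?p (7*t/16) \<ge> N * (7*t/16) - N*t/10000" "?p (6*t/16) \<le> N * (6*t/16) + N*t/10000"
      "?p (10*t/16) \<le> N * (10*t/16) + N*t/10000" "?p (9*t/16) \<ge> N * (9*t/16) - N*t/10000"
      using pL[of "7*t/16"] pU[of "6*t/16"] pU[of "10*t/16"] pL[of "9*t/16"] t by auto
    have j: "?p (7*t/16) \<le> \<gamma> + N / 5 + J (7*t/16) + n * ln 2" "J (6*t/16) \<le> ?p (6*t/16) - \<gamma> + N / 5"
       "J (10*t/16) \<le> ?p (10*t/16) - \<gamma> + N / 5" "?p (9*t/16) \<le> \<gamma> + N / 5 + J (9*t/16) + n * ln 2"
      using JU[of "7*t/16"] JL[of "6*t/16"] JL[of "10*t/16"] JU[of "9*t/16"] t by auto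
    have "real n * ln 2 \<le> real n * 1" using ln2 by (intro mult_left_mono) auto
    then have nl: "n * ln 2 \<le> 11 * N" using n by linarith
    \<comment> \<open>Four deviations of \<open>?p\<close> from the linear function enter. The term
      \<open>23 * N\<close> covers \<open>4 * N / 5\<close> from the cofactor and
      \<open>2 * n * ln 2\<close> from the gap between mean and maximum.\<close>
    have "t / 16 * (m3 - m1) \<le> 4 * (N * t / 10000) + 23 * N"
      using e1 e3 b1 j nl N by (simp add: algebra_simps)
    also have "23 * N \<le> 23 * (N * t / 100000)" using N t by simp
    finally have "t * (m3 - m1) \<le> t * (N * (1008 / 100000))" by (simp add: algebra_simps)
    then have "m3 - m1 \<le> N * (1008 / 100000)" using t by simp
    then show ?thesis using card N by simp
  qed

  \<comment> \<open>Choice of the radius\<close>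
  define R where "R = exp (t / 2)"
  have R: "0 < R" by (simp add: R_def)
  \<comment> \<open>Only zeros of modulus at most \<open>4 * R\<close> can be close to a circle of
    radius between \<open>R\<close> and \<open>2 * R\<close>. In the coordinate \<open>y\<close> the
    difference \<open>r - cmod (a i)\<close> is \<open>R * (x - y i)\<close>.\<close>
  define I where "I = {i\<in>mid. cmod (a i) \<le> 4 * R}"
  define y where "y i = cmod (a i) / R - 1" for i
  have "finite I" using fmid by (simp add: I_def)
  then obtain x where x: "0 \<le> x" "x \<le> 1" "\<And>i. i \<in> I \<Longrightarrow> x \<noteq> y i"
    "(\<Sum>i\<in>I. - ln \<bar>x - y i\<bar>) \<le> 3 * real (card I)"
    using exists_point_far_from_all[of I y] by blast
  define s where "s = t / 2 + ln (1 + x)"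
  define r where "r = R * (1 + x)"
  have r: "exp s = r" using x by (simp add: s_def r_def R_def exp_add)
  have r2: "R \<le> r" "r \<le> 2 * R" "0 < r" using x R by (auto simp: r_def mult_le_cancel_left1 mult.commute[of 2])
  have ln1x: "0 \<le> ln (1 + x)" "ln (1 + x) \<le> 1" using x ln_add_one_self_le_self[of x] by auto
  have s: "0 \<le> s" "s \<le> 5 * t / 8" using t ln1x by (auto simp: s_def)
  \<comment> \<open>For zeros outside the annulus \<open>d\<close> bounds the ratio of the smaller
    to the larger of \<open>r\<close> and \<open>cmod (a i)\<close>; the factor 2 allows for
    \<open>r\<close> up to \<open>2 * R\<close>.\<close>
  define d where "d = 2 * exp (- t / 16)"
  have d: "d \<le> 1 / 2500" using exp16 by (simp add: d_def)
  have near: "r \<noteq> cmod (a i) \<and> ln ((r + cmod (a i)) / \<bar>r - cmod (a i)\<bar>) \<le>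
      4 * d + (if i \<in> mid then 5 else 0) + (if i \<in> I then - ln \<bar>x - y i\<bar> else 0)" (is "_ \<and> ?l \<le> _") if i: "i < n" for i
  proof -
    have d0: "0 \<le> d" by (simp add: d_def)
    consider "i \<in> I" | "i \<in> mid" "cmod (a i) > 4 * R" | "cmod (a i) < exp (7 * t / 16)"
      | "cmod (a i) > exp (9 * t / 16)"
      using i unfolding mid_def I_def mem_Collect_eq not_le[symmetric] by blast
    then show ?thesis
    proof cases
      case 1
      have eq: "r - cmod (a i) = R * (x - y i)" using R by (simp add: r_def y_def field_simps)
      then have "r \<noteq> cmod (a i)" using x(3)[OF 1] R by auto
      moreover have "?l \<le> ln ((6 * R) / (R * \<bar>x - y i\<bar>))"
      proof (rule ln_mono)
        have D: "\<bar>r - cmod (a i)\<bar> = R * \<bar>x - y i\<bar>" "0 < R * \<bar>x - y i\<bar>"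
          unfolding eq abs_mult using R x(3)[OF 1] by auto
        have "r + cmod (a i) \<le> 6 * R" using 1 r2 by (simp add: I_def)
        then show "(r + cmod (a i)) / \<bar>r - cmod (a i)\<bar> \<le> (6 * R) / (R * \<bar>x - y i\<bar>)"
          unfolding D(1) using D(2) by (intro divide_right_mono) auto
        have "0 < r + cmod (a i)" using r2 by (simp add: add_pos_nonneg)
        then show "0 < (r + cmod (a i)) / \<bar>r - cmod (a i)\<bar>" unfolding D(1) using D(2) by (intro divide_pos_pos)
      qed
      moreover have "ln ((6 * R) / (R * \<bar>x - y i\<bar>)) = ln 6 - ln \<bar>x - y i\<bar>"
        using R x(3)[OF 1] by (simp add: ln_div)
      moreover have "ln 6 \<le> (5::real)" using ln_le_minus_one[of 6] by simp
      ultimately show ?thesis using 1 d0 by (auto simp: I_def)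
    next
      case 2
      then have "(r + cmod (a i)) / \<bar>r - cmod (a i)\<bar> \<le> 6" using r2 R by (simp add: field_simps)
      then have "?l \<le> ln 6" using r2 2 R by (intro ln_mono) (auto intro!: divide_pos_pos add_pos_nonneg)
      then have "?l \<le> 5" using ln_le_minus_one[of "6::real"] by linarith
      then show ?thesis using 2 r2 R d0 by (auto simp: I_def)
    next
      case 3
      have "exp (7 * t / 16) = exp (- t / 16) * R" by (simp add: R_def flip: exp_add)
      also have "\<dots> \<le> exp (- t / 16) * r" using r2 by simp
      also have "\<dots> \<le> d * r" using r2 by (simp add: d_def)
      finally have A: "cmod (a i) \<le> d * r" using 3 by simp
      moreover have "d * r < r" using d r2 mult_right_mono[of d "1/2500" r] by linarith
      ultimately have "cmod (a i) < r" by simp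
      moreover have "i \<notin> mid" using 3 by (auto simp: mid_def)
      ultimately show ?thesis using ln_ratio_le[OF _ r2(3) A] d by (auto simp: I_def)
    next
      case 4
      have "r \<le> 2 * R" using r2 by simp
      also have "\<dots> = d * exp (9 * t / 16)" by (simp add: R_def d_def flip: exp_add)
      also have "\<dots> \<le> d * cmod (a i)" using 4 d0 by (intro mult_left_mono) auto
      finally have A: "r \<le> d * cmod (a i)" .
      have ai: "0 < cmod (a i)" using 4 by (meson exp_gt_zero less_trans)
      have "d * cmod (a i) < cmod (a i)" using d ai mult_right_mono[of d "1/2500" "cmod (a i)"] by linarith
      then have "r < cmod (a i)" using A by simp
      moreover have "i \<notin> mid" using 4 by (auto simp: mid_def)
      ultimately show ?thesis using ln_ratio_le[OF _ ai A] d r2 by (auto simp: I_def add.commute)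
    qed
  qed
  have loss: "(\<Sum>i<n. ln ((r + cmod (a i)) / \<bar>r - cmod (a i)\<bar>)) \<le> N / 2"
  proof -
    have sub: "mid \<subseteq> {..<n}" "I \<subseteq> {..<n}" "I \<subseteq> mid" by (auto simp: mid_def I_def)
    have "(\<Sum>i<n. ln ((r + cmod (a i)) / \<bar>r - cmod (a i)\<bar>)) \<le>
      (\<Sum>i<n. 4 * d + (if i \<in> mid then 5 else 0) + (if i \<in> I then - ln \<bar>x - y i\<bar> else 0))"
      using near by (intro sum_mono) auto
    also have "\<dots> = n * (4 * d) + 5 * card mid + (\<Sum>i\<in>I. - ln \<bar>x - y i\<bar>)"
      using sub by (simp add: sum.distrib sum.If_cases Int_absorb1)
    \<comment> \<open>A zero in the annulus costs at most 5, plus 3 on average over \<open>I\<close>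
      by the choice of \<open>x\<close>. The total is at most
      \<open>0.0176 * N + 0.16 * N\<close>.\<close>
    also have "\<dots> \<le> n * (4 * d) + 5 * card mid + 3 * card mid"
      using x(4) card_mono[OF fmid sub(3)] by simp
    also have "n * (4 * d) \<le> (11 * N) * (4 * (1/2500))" using n d by (intro mult_mono) (auto simp: d_def)
    finally show ?thesis using mid N by simp
  qed

  \<comment> \<open>Comparing the maximum with the other values on the circle\<close>
  show thesis
  proof (rule that)
    show "t / 2 \<le> s" "s \<le> t / 2 + 1" using ln1x by (auto simp: s_def)
    fix z assume z: "cmod z = exp s"
    obtain w where w: "cmod w = exp s" "cmod (f w) = exp (?p s)" using top by blast
    have gz: "0 < cmod (g z)" "0 < cmod (g w)" using gnz exp_le_\<rho>[OF s(2)] z w by auto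
    have pos: "0 < \<bar>r - cmod (a i)\<bar>" "0 < r + cmod (a i)" if "i < n" for i
      using near[OF that] r2 by (auto intro: add_pos_nonneg)
    \<comment> \<open>Linear factors are bounded by \<open>r + cmod (a i)\<close> from above at the
      maximum point \<open>w\<close>, and by \<open>\<bar>r - cmod (a i)\<bar>\<close> from below at
      \<open>z\<close>; \<open>loss\<close> controls the quotient.\<close>
    have W: "?p s \<le> (\<Sum>i<n. ln (r + cmod (a i))) + \<gamma> + N / 5"
    proof -
      have "exp (?p s) = (\<Prod>i<n. cmod (w - a i)) * cmod (g w)"
        unfolding w(2)[symmetric] fac norm_mult by (simp add: prod_norm)
      also have "\<dots> \<le> (\<Prod>i<n. r + cmod (a i)) * cmod (g w)"
        using norm_triangle_ineq4[of w] w(1) r by (intro mult_right_mono prod_mono) auto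
      finally have "?p s \<le> ln ((\<Prod>i<n. r + cmod (a i)) * cmod (g w))"
        using gz pos by (subst ln_ge_iff) (auto intro!: mult_pos_pos prod_pos)
      also have "\<dots> = (\<Sum>i<n. ln (r + cmod (a i))) + ln (cmod (g w))"
        using gz pos by (intro ln_prod_times) auto
      finally show ?thesis using gU[of w] w s by simp
    qed
    have Z: "exp ((\<Sum>i<n. ln \<bar>r - cmod (a i)\<bar>) + \<gamma> - N / 5) \<le> cmod (f z)"
    proof -
      have "exp ((\<Sum>i<n. ln \<bar>r - cmod (a i)\<bar>) + \<gamma> - N / 5) \<le> exp ((\<Sum>i<n. ln \<bar>r - cmod (a i)\<bar>) + ln (cmod (g z)))"
        using gL[of z] z s by simp
      also have "\<dots> = (\<Prod>i<n. \<bar>r - cmod (a i)\<bar>) * cmod (g z)"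
        using gz pos by (simp add: exp_add exp_sum)
      also have "\<dots> \<le> (\<Prod>i<n. cmod (z - a i)) * cmod (g z)"
        using norm_triangle_ineq3[of z] z r by (intro mult_right_mono prod_mono) auto
      also have "\<dots> = cmod (f z)" by (simp add: fac norm_mult prod_norm)
      finally show ?thesis .
    qed
    have "(\<Sum>i<n. ln (r + cmod (a i))) - (\<Sum>i<n. ln \<bar>r - cmod (a i)\<bar>) =
      (\<Sum>i<n. ln ((r + cmod (a i)) / \<bar>r - cmod (a i)\<bar>))"
      unfolding sum_subtractf[symmetric] using pos by (intro sum.cong refl ln_divide_pos[symmetric]) auto
    then have "?p s - N \<le> (\<Sum>i<n. ln \<bar>r - cmod (a i)\<bar>) + \<gamma> - N / 5" using loss W N by linarith
    then show "exp (?p s - N) \<le> cmod (f z)" using Z by (meson exp_le_cancel_iff order_trans)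
  qed
qed

theorem log_regular_if_min_modulus_small:
  fixes K :: real
  assumes K: "2 \<le> K" and f: "transcendental_entire f"
    and R: "\<And>r. r \<ge> R \<Longrightarrow> min_modulus f r \<le> max_modulus f r powr (1 - K / ln r)"
  shows "log_regular f"
proof -
  let ?p = "log_max_modulus f"
  have hol: "f holomorphic_on UNIV" using f by (simp add: transcendental_entire_def)
  have nc: "\<not> f constant_on UNIV" using transcendental_entire_nonconstant[OF f] .
  have M: "max_modulus f (exp x) = exp (?p x)" for x
    using max_modulus_pos[OF hol nc, of "exp x"] by (simp add: log_max_modulus_def)
  note conv = log_max_modulus_convex[OF hol nc]
  \<comment> \<open>Equal to the relative tolerance of \<open>large_min_modulus_on_circle\<close>,
    since the lower estimate in \<open>near\<close> loses \<open>c * N * t\<close>.\<close>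
  define c :: real where "c = 1 / 10000"
  have "filterlim ?p at_top at_top" unfolding log_max_modulus_def[abs_def]
    by (intro filterlim_compose[OF ln_at_top] filterlim_compose[OF max_modulus_at_top[OF hol nc]] exp_at_top)
  \<comment> \<open>This makes \<open>\<bar>?p 0\<bar>\<close> smaller than the tolerance. The bound
    \<open>2 * R \<le> t\<close> below puts \<open>exp s\<close>, for \<open>t / 2 \<le> s\<close>,
    in the range of the hypothesis.\<close>
  then have "\<forall>\<^sub>F t in at_top. 10000 * \<bar>?p 0\<bar> + 1 \<le> ?p t" by (simp add: filterlim_at_top)
  moreover have "\<forall>\<^sub>F t in at_top. max 100000 (2 * R) \<le> (t::real)" by (rule eventually_ge_at_top)
  ultimately have "\<forall>\<^sub>F t in at_top. \<exists>D. (?p has_real_derivative D) (at_right t) \<and> D / ?p t \<ge> (1 + c) / t"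
  proof eventually_elim
    case (elim t)
    then have t: "100000 \<le> t" "2 * R \<le> t" and pt: "10000 * \<bar>?p 0\<bar> \<le> ?p t" "?p t > 0" by auto
    obtain D where D: "(?p has_real_derivative D) (at_right t)" "\<And>s. s \<le> t \<Longrightarrow> ?p s \<ge> ?p t - D * (t - s)"
      using convex_on_has_right_derivative[OF conv] by metis
    have "(1 + c) * ?p t \<le> D * t"
    proof (rule ccontr)
      assume less: "\<not> ?thesis"
      define N where "N = ?p t / t"
      have N: "N > 0" using pt t by (simp add: N_def)
      have Nt: "?p t = N * t" using t by (simp add: N_def)
      have DN: "D \<le> (1 + c) * N" using less t by (simp add: N_def field_simps)
      \<comment> \<open>From above by the chord between 0 and \<open>t\<close>, from below by the
        line through the point at \<open>t\<close> with slope \<open>D\<close>, which exceeds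
        \<open>N\<close> by little.\<close>
      have near: "\<bar>?p x - N * x\<bar> \<le> N * t / 10000" if x: "0 \<le> x" "x \<le> t" for x
      proof (rule abs_leI)
        have "?p ((1 - x/t) *\<^sub>R 0 + (x/t) *\<^sub>R t) \<le> (1 - x/t) * ?p 0 + x/t * ?p t"
          by (rule convex_onD[OF conv]) (use x t in auto)
        then have "?p x \<le> (1 - x/t) * ?p 0 + N * x" using t by (simp add: N_def mult.commute)
        moreover have "(1 - x/t) * ?p 0 \<le> \<bar>?p 0\<bar>"
        proof -
          have "\<bar>(1 - x/t) * ?p 0\<bar> \<le> 1 * \<bar>?p 0\<bar>"
            unfolding abs_mult using x t by (intro mult_right_mono) auto
          then show ?thesis by linarith
        qed
        ultimately show "?p x - N * x \<le> N * t / 10000" using pt Nt by simp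
        have "D * (t - x) \<le> (1 + c) * N * (t - x)" using DN x by (intro mult_right_mono) auto
        also have "\<dots> = N * (t - x) + c * N * (t - x)" by (simp add: algebra_simps)
        also have "c * N * (t - x) \<le> c * N * t" using N x by (intro mult_left_mono) (auto simp: c_def)
        finally show "- (?p x - N * x) \<le> N * t / 10000" using D(2)[OF x(2)] Nt
          by (simp add: c_def algebra_simps)
      qed
      obtain s where s: "t / 2 \<le> s" "s \<le> t / 2 + 1"
        "\<And>z. cmod z = exp s \<Longrightarrow> exp (?p s - N) \<le> cmod (f z)"
        using large_min_modulus_on_circle[OF hol nc N t(1) near] by blast
      have "R \<le> exp s" using s(1) t exp_ge_add_one_self[of s] by linarith
      have "exp (?p s - N) \<le> min_modulus f (exp s)"
        using s(3) by (intro min_modulus_greatest) auto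
      also have "\<dots> \<le> max_modulus f (exp s) powr (1 - K / ln (exp s))" by (rule R) fact
      also have "\<dots> = exp (?p s * (1 - K / s))" by (simp add: M powr_def mult.commute)
      \<comment> \<open>This is impossible for \<open>2 \<le> K\<close>, because
        \<open>?p s / s\<close> is at least \<open>3/4 * N\<close>.\<close>
      finally have "?p s * (K / s) \<le> N" by (simp add: algebra_simps)
      moreover have s0: "0 < s" using s t by linarith
      ultimately have up: "?p s * K \<le> N * s" by (simp add: field_simps)
      have "?p s \<ge> 3/4 * (N * s)"
      proof -
        have "?p s \<ge> N * s - N * t / 10000" using near[of s] s t by linarith
        moreover have "N * t \<le> N * (2 * s)" using N s by (intro mult_left_mono) auto
        moreover have "N * (2 * s) = 2 * (N * s)" "0 < N * s" using N s0 by auto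
        ultimately show ?thesis by linarith
      qed
      moreover have Ns: "0 < N * s" using N s0 by simp
      ultimately have "3/4 * (N * s) * 2 \<le> ?p s * K" using K by (intro mult_mono) auto
      with up Ns show False by linarith
    qed
    then have "(1 + c) / t \<le> D / ?p t" using pt t by (simp add: field_simps)
    then show ?case using D(1) by blast
  qed
  moreover have "c > 0" by (simp add: c_def)
  ultimately show ?thesis using f unfolding log_regular_def by blast
qed

subsection \<open>Lifting through an entire function\<close>

text \<open>The set where the two lifts agree is closed, and it is open because \<open>f\<close> is
  injective near every point that is not critical.\<close>

lemma lift_unique:
  assumes hol: "f holomorphic_on UNIV" and S: "connected S"
    and cont: "continuous_on S g1" "continuous_on S g2"
    and eq: "\<And>x. x \<in> S \<Longrightarrow> f (g1 x) = f (g2 x)"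
    and reg: "\<And>x. x \<in> S \<Longrightarrow> deriv f (g1 x) \<noteq> 0"
    and a: "a \<in> S" "g1 a = g2 a" and x: "x \<in> S"
  shows "g1 x = g2 x"
proof -
  define E where "E = {x\<in>S. g1 x - g2 x = 0}"
  have "closedin (top_of_set S) E" unfolding E_def
    by (intro continuous_closedin_preimage_constant continuous_intros cont)
  moreover have "openin (top_of_set S) E"
  proof (subst openin_subopen, intro ballI)
    fix y assume y: "y \<in> E"
    then have yS: "y \<in> S" "g1 y = g2 y" by (auto simp: E_def)
    obtain r where r: "r > 0" "inj_on f (ball (g1 y) r)"
      using has_complex_derivative_locally_injective[OF hol UNIV_I open_UNIV reg[OF yS(1)]] by blast
    define T where "T = (S \<inter> g1 -` ball (g1 y) r) \<inter> (S \<inter> g2 -` ball (g1 y) r)"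
    have "openin (top_of_set S) T" unfolding T_def
      by (intro openin_Int continuous_openin_preimage_gen cont open_ball)
    moreover have "y \<in> T" using yS r by (auto simp: T_def)
    moreover have "T \<subseteq> E" using r(2) eq by (auto simp: T_def E_def inj_on_def)
    ultimately show "\<exists>T. openin (top_of_set S) T \<and> y \<in> T \<and> T \<subseteq> E" by blast
  qed
  moreover have "a \<in> E" using a by (simp add: E_def)
  ultimately have "E = S" using S unfolding connected_clopen by blast
  then show ?thesis using x by (auto simp: E_def)
qed

text \<open>If the path tended to infinity, \<open>w\<close> would be an asymptotic value. Otherwise
  it has a finite cluster point \<open>z\<close> with \<open>f z = w\<close>, and since
  \<open>w\<close> is not critical, \<open>z\<close> is isolated in its fibre and traps the
  path.\<close>

lemma path_lift_converges:
  fixes \<gamma> :: "real \<Rightarrow> complex"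
  assumes hol: "f holomorphic_on UNIV" and cont: "continuous_on {0..<1} \<gamma>"
    and lim: "((\<lambda>t. f (\<gamma> t)) \<longlongrightarrow> w) (at_left 1)"
    and w: "w \<notin> critical_values f" "w \<notin> asymptotic_values f"
  obtains z where "(\<gamma> \<longlongrightarrow> z) (at_left 1)" "f z = w"
proof -
  have "\<not> filterlim \<gamma> at_infinity (at_left 1)"
  proof
    assume inf: "filterlim \<gamma> at_infinity (at_left 1)"
    \<comment> \<open>Reparametrises the path over \<open>{0..}\<close>, as the definition of
      \<open>asymptotic_values\<close> requires.\<close>
    define \<tau> :: "real \<Rightarrow> real" where "\<tau> u = 1 - 1 / (1 + u)" for u
    have "filterlim \<tau> (at_left 1) at_top" unfolding \<tau>_def by real_asymp
    then have "filterlim (\<lambda>u. \<gamma> (\<tau> u)) at_infinity at_top" "((\<lambda>u. f (\<gamma> (\<tau> u))) \<longlongrightarrow> w) at_top"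
      using filterlim_compose[OF inf] filterlim_compose[OF lim] by auto
    moreover have "continuous_on {0..} (\<lambda>u. \<gamma> (\<tau> u))"
      by (rule continuous_on_compose2[OF cont]) (auto simp: \<tau>_def field_simps intro!: continuous_intros)
    ultimately have "w \<in> asymptotic_values f" unfolding asymptotic_values_def by blast
    then show False using w by blast
  qed
  then obtain B where B: "\<not> (\<forall>\<^sub>F t in at_left 1. B \<le> cmod (\<gamma> t))"
    unfolding filterlim_at_infinity[OF order_refl] by blast
  have "\<forall>n::nat. \<exists>t. 1 - 1 / (real n + 1) < t \<and> 0 < t \<and> t < 1 \<and> cmod (\<gamma> t) \<le> B"
  proof (intro allI, rule ccontr)
    fix n :: nat
    assume neg: "\<not> (\<exists>t. 1 - 1 / (real n + 1) < t \<and> 0 < t \<and> t < 1 \<and> cmod (\<gamma> t) \<le> B)"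
    have "\<forall>\<^sub>F t in at_left 1. max 0 (1 - 1 / (real n + 1)) < t \<and> t < 1"
      unfolding eventually_at_left_field by (intro exI[of _ "max 0 (1 - 1 / (real n + 1))"]) auto
    then have "\<forall>\<^sub>F t in at_left 1. B \<le> cmod (\<gamma> t)"
    proof (rule eventually_mono)
      fix t assume "max 0 (1 - 1 / (real n + 1)) < t \<and> t < 1"
      then have "1 - 1 / (real n + 1) < t" "0 < t" "t < 1" by linarith+
      then have "\<not> cmod (\<gamma> t) \<le> B" using neg by blast
      then show "B \<le> cmod (\<gamma> t)" by linarith
    qed
    then show False using B by blast
  qed
  then obtain t where t: "\<And>n::nat. 1 - 1 / (real n + 1) < t n" "\<And>n. 0 < t n" "\<And>n. t n < 1" "\<And>n. cmod (\<gamma> (t n)) \<le> B"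
    by metis
  have tlim: "t \<longlonglongrightarrow> 1"
  proof (rule tendsto_sandwich)
    show "(\<lambda>n::nat. 1 - 1 / (real n + 1)) \<longlonglongrightarrow> 1" by real_asymp
  qed (use t in \<open>auto intro!: always_eventually less_imp_le\<close>)
  have "\<forall>n. (\<gamma> \<circ> t) n \<in> cball 0 B" using t by simp
  moreover have "seq_compact (cball (0::complex) B)" using compact_cball compact_imp_seq_compact by blast
  ultimately obtain l \<sigma> where "strict_mono (\<sigma> :: nat \<Rightarrow> nat)" "((\<gamma> \<circ> t) \<circ> \<sigma>) \<longlonglongrightarrow> l"
    using seq_compactE by metis
  then obtain z \<sigma> where z: "strict_mono (\<sigma> :: nat \<Rightarrow> nat)" "(\<lambda>n. \<gamma> (t (\<sigma> n))) \<longlonglongrightarrow> z"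
    by (simp add: o_def)
  have ts: "filterlim (\<lambda>n. t (\<sigma> n)) (at_left 1) sequentially"
  proof -
    have "t (\<sigma> n) \<noteq> 1" for n using t(3)[of "\<sigma> n"] by simp
    then show ?thesis using LIMSEQ_subseq_LIMSEQ[OF tlim z(1)] t(3) by (simp add: filterlim_at o_def)
  qed
  have contf: "isCont f u" for u
    using holomorphic_on_imp_continuous_on[OF hol] continuous_on_eq_continuous_at[OF open_UNIV] by blast
  have "(\<lambda>n. f (\<gamma> (t (\<sigma> n)))) \<longlonglongrightarrow> f z" using isCont_tendsto_compose[OF contf z(2)] .
  moreover have "(\<lambda>n. f (\<gamma> (t (\<sigma> n)))) \<longlonglongrightarrow> w" using filterlim_compose[OF lim ts] .
  ultimately have fz: "f z = w" by (rule LIMSEQ_unique)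
  then have "deriv f z \<noteq> 0" using w(1) by (auto simp: critical_values_def)
  then obtain r where r: "r > 0" "inj_on f (ball z r)"
    using has_complex_derivative_locally_injective[OF hol UNIV_I open_UNIV] by blast
  have "(\<gamma> \<longlongrightarrow> z) (at_left 1)"
  proof (rule tendstoI)
    fix e :: real assume "0 < e"
    define d where "d = min e r / 2"
    have d: "0 < d" "d < e" "d < r" using \<open>0 < e\<close> r by (auto simp: d_def)
    \<comment> \<open>The positive minimum of \<open>cmod (f u - w)\<close> on this circle is a
      barrier: once \<open>f (\<gamma> t)\<close> is closer to \<open>w\<close>, the path cannot
      cross the circle.\<close>
    have "sphere z d \<noteq> {}" using d by simp
    moreover have "continuous_on (sphere z d) (\<lambda>u. cmod (f u - w))"
      by (intro continuous_intros continuous_on_subset[OF holomorphic_on_imp_continuous_on[OF hol]]) auto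
    ultimately obtain u where u: "u \<in> sphere z d" "\<And>v. v \<in> sphere z d \<Longrightarrow> cmod (f u - w) \<le> cmod (f v - w)"
      using continuous_attains_inf[OF compact_sphere] by blast
    have "f u \<noteq> f z" using inj_onD[OF r(2), of u z] u(1) d by (auto simp: dist_commute)
    then have m: "0 < cmod (f u - w)" using fz by simp
    have "\<forall>\<^sub>F t in at_left 1. dist (f (\<gamma> t)) w < cmod (f u - w)" using tendstoD[OF lim m] .
    then obtain b where b: "b < 1" "\<And>t. b < t \<Longrightarrow> t < 1 \<Longrightarrow> dist (f (\<gamma> t)) w < cmod (f u - w)"
      unfolding eventually_at_left_field by blast
    have avoid: "dist z (\<gamma> t) \<noteq> d" if "b < t" "t < 1" for t
      using u(2)[of "\<gamma> t"] b(2)[OF that] by (auto simp: dist_norm)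
    have "\<forall>\<^sub>F n in sequentially. dist (\<gamma> (t (\<sigma> n))) z < d" using tendstoD[OF z(2) d(1)] .
    moreover have "\<forall>\<^sub>F n in sequentially. b < t (\<sigma> n)"
      using order_tendstoD(1)[OF LIMSEQ_subseq_LIMSEQ[OF tlim z(1)] b(1)] by (simp add: o_def)
    ultimately obtain n where n: "dist (\<gamma> (t (\<sigma> n))) z < d" "b < t (\<sigma> n)"
      using eventually_happens'[OF sequentially_bot eventually_conj] by blast
    have "dist (\<gamma> s) z < d" if s: "t (\<sigma> n) \<le> s" "s < 1" for s
    proof (rule ccontr)
      assume "\<not> ?thesis"
      then have ge: "d \<le> dist z (\<gamma> s)" by (simp add: dist_commute)
      have "continuous_on {t (\<sigma> n)..s} (\<lambda>s. dist z (\<gamma> s))"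
        using t(2)[of "\<sigma> n"] s by (intro continuous_intros continuous_on_subset[OF cont]) auto
      then obtain x where "t (\<sigma> n) \<le> x" "x \<le> s" "dist z (\<gamma> x) = d"
        using IVT'[of "\<lambda>s. dist z (\<gamma> s)" "t (\<sigma> n)" d s] n ge s(1) by (auto simp: dist_commute)
      then show False using avoid[of x] n s by auto
    qed
    then have "dist (\<gamma> s) z < e" if "t (\<sigma> n) < s" "s < 1" for s using that d(2) by (meson less_imp_le less_trans)
    then show "\<forall>\<^sub>F s in at_left 1. dist (\<gamma> s) z < e"
      unfolding eventually_at_left_field using t(3) by blast
  qed
  then show thesis using that fz by blast
qed

text \<open>The ball \<open>ball z r\<close> on which \<open>f\<close> is injective is part of the
  conclusion, so that \<open>k\<close> can be compared with another lift taking a value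
  there.\<close>

lemma local_lift:
  assumes hol: "f holomorphic_on UNIV" and "deriv f z \<noteq> 0" "f z = h b" "open D" "b \<in> D"
    and h: "continuous_on D (h :: complex \<Rightarrow> complex)"
  obtains e k r where "0 < e" "ball b e \<subseteq> D" "continuous_on (ball b e) k" "k b = z"
    "\<And>x. x \<in> ball b e \<Longrightarrow> f (k x) = h x" "0 < r" "inj_on f (ball z r)" "\<And>x. x \<in> ball b e \<Longrightarrow> k x \<in> ball z r"
proof -
  obtain r where r: "r > 0" "open (f ` ball z r)" "inj_on f (ball z r)"
    using has_complex_derivative_locally_invertible[OF hol UNIV_I open_UNIV assms(2)] by blast
  have "f holomorphic_on ball z r" using hol holomorphic_on_subset by blast
  then obtain k where k: "k holomorphic_on f ` ball z r" "\<And>u. u \<in> ball z r \<Longrightarrow> k (f u) = u"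
    using holomorphic_has_inverse[OF _ open_ball r(3)] by metis
  have "open (D \<inter> h -` (f ` ball z r))"
    by (rule continuous_open_preimage[OF h \<open>open D\<close> r(2)])
  moreover have "b \<in> D \<inter> h -` (f ` ball z r)" using assms r(1) by (auto intro!: image_eqI[of _ f z])
  ultimately obtain e where e: "e > 0" "ball b e \<subseteq> D \<inter> h -` (f ` ball z r)"
    using open_contains_ball by blast
  show thesis
  proof (rule that[of e "\<lambda>x. k (h x)" r])
    show "ball b e \<subseteq> D" using e by blast
    show "continuous_on (ball b e) (\<lambda>x. k (h x))"
      by (rule continuous_on_compose2[OF holomorphic_on_imp_continuous_on[OF k(1)] continuous_on_subset[OF h]]) (use e in auto)
    show "k (h b) = z" using k(2)[of z] r(1) assms(3) by simp
    show "f (k (h x)) = h x" "k (h x) \<in> ball z r" if x: "x \<in> ball b e" for x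
    proof -
      obtain u where "u \<in> ball z r" "h x = f u" using x e(2) by blast
      then show "f (k (h x)) = h x" "k (h x) \<in> ball z r" using k(2) by auto
    qed
  qed (use e r in auto)
qed

text \<open>The lift has a limit along every radius by \<open>path_lift_converges\<close>. A local
  lift through that limit continues it past the boundary point, and compactness of the circle gives
  a uniform gain in radius.\<close>

lemma disc_lift_extend:
  fixes h :: "complex \<Rightarrow> complex"
  assumes hol: "f holomorphic_on UNIV" and h: "continuous_on (ball 0 1) h"
    and reg: "\<And>x. x \<in> ball 0 1 \<Longrightarrow> h x \<notin> critical_values f \<union> asymptotic_values f"
    and \<rho>: "0 < \<rho>" "\<rho> < 1" and g: "continuous_on (ball 0 \<rho>) g" "\<And>x. x \<in> ball 0 \<rho> \<Longrightarrow> f (g x) = h x"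
  obtains \<rho>' G where "\<rho> < \<rho>'" "\<rho>' \<le> 1" "continuous_on (ball 0 \<rho>') G"
    "\<And>x. x \<in> ball 0 \<rho>' \<Longrightarrow> f (G x) = h x" "G 0 = g 0"
proof -
  have nz: "deriv f z \<noteq> 0" if "f z = h x" "x \<in> ball 0 1" for z x
  proof
    assume "deriv f z = 0"
    then have "f z \<in> critical_values f" by (auto simp: critical_values_def)
    then show False using reg[OF that(2)] that(1) by simp
  qed
  have "\<exists>e k. 0 < e \<and> ball b e \<subseteq> ball 0 1 \<and> continuous_on (ball b e) k \<and> (\<forall>x\<in>ball b e. f (k x) = h x) \<and>
      (\<forall>x\<in>ball b e \<inter> ball 0 \<rho>. k x = g x)" if b: "b \<in> sphere 0 \<rho>" for b :: complex
  proof -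
    have b1: "b \<in> ball 0 1" using b \<rho> by simp
    define \<gamma> where "\<gamma> t = g (of_real t * b)" for t :: real
    have inb: "of_real t * b \<in> ball 0 \<rho>" if "0 \<le> t" "t < 1" for t :: real
      using b that \<rho> by (simp add: norm_mult)
    have "continuous_on {0..<1} \<gamma>" unfolding \<gamma>_def
      by (rule continuous_on_compose2[OF g(1)]) (use inb in \<open>auto intro!: continuous_intros\<close>)
    moreover have "((\<lambda>t. f (\<gamma> t)) \<longlongrightarrow> h b) (at_left 1)"
    proof (rule Lim_transform_eventually)
      have "isCont h b" using h b1 by (simp add: continuous_on_eq_continuous_at)
      moreover have "((\<lambda>t. of_real t * b) \<longlongrightarrow> b) (at_left (1::real))"
        by (auto intro!: tendsto_eq_intros)
      ultimately show "((\<lambda>t. h (of_real t * b)) \<longlongrightarrow> h b) (at_left (1::real))"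
        by (rule isCont_tendsto_compose)
      have "\<forall>\<^sub>F t in at_left (1::real). 0 < t \<and> t < 1"
        unfolding eventually_at_left_field by (intro exI[of _ 0]) auto
      then show "\<forall>\<^sub>F t in at_left 1. h (of_real t * b) = f (\<gamma> t)"
        by (rule eventually_mono) (use inb g(2) in \<open>auto simp: \<gamma>_def\<close>)
    qed
    ultimately obtain z where z: "(\<gamma> \<longlongrightarrow> z) (at_left 1)" "f z = h b"
      using path_lift_converges[OF hol] reg[OF b1] by blast
    obtain e k r where k: "0 < e" "ball b e \<subseteq> ball 0 1" "continuous_on (ball b e) k" "k b = z"
      "\<And>x. x \<in> ball b e \<Longrightarrow> f (k x) = h x" "0 < r" "inj_on f (ball z r)" "\<And>x. x \<in> ball b e \<Longrightarrow> k x \<in> ball z r"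
      using local_lift[OF hol nz[OF z(2) b1] z(2) open_ball b1 h] by blast
    have "\<forall>\<^sub>F t in at_left 1. dist (\<gamma> t) z < r" using tendstoD[OF z(1) k(6)] .
    moreover have "((\<lambda>t. of_real t * b) \<longlongrightarrow> b) (at_left (1::real))" by (auto intro!: tendsto_eq_intros)
    then have "\<forall>\<^sub>F t in at_left (1::real). dist (of_real t * b) b < e" using tendstoD k(1) by blast
    moreover have "\<forall>\<^sub>F t in at_left (1::real). 0 < t \<and> t < 1"
      unfolding eventually_at_left_field by (intro exI[of _ 0]) auto
    ultimately have "\<forall>\<^sub>F t in at_left (1::real). dist (\<gamma> t) z < r \<and> dist (of_real t * b) b < e \<and> 0 < t \<and> t < 1"
      by eventually_elim auto
    then obtain t :: real where t: "dist (\<gamma> t) z < r" "dist (of_real t * b) b < e" "0 < t" "t < 1"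
      using eventually_happens'[OF trivial_limit_at_left_real] by blast
    \<comment> \<open>Both lifts take values at \<open>a\<close> in the ball where \<open>f\<close>
      is injective, so they agree at \<open>a\<close> and, by uniqueness, on the convex
      overlap.\<close>
    define a where "a = of_real t * b"
    have a: "a \<in> ball b e \<inter> ball 0 \<rho>" using t inb[of t] by (auto simp: a_def dist_commute)
    have "k a = g a"
    proof (rule inj_onD[OF k(7)])
      show "f (k a) = f (g a)" using a k(5) g(2) by auto
      show "k a \<in> ball z r" using k(8) a by blast
      show "g a \<in> ball z r" using t(1) by (simp add: \<gamma>_def a_def dist_commute)
    qed
    have "k x = g x" if "x \<in> ball b e \<inter> ball 0 \<rho>" for x
    proof (rule lift_unique[OF hol, of "ball b e \<inter> ball 0 \<rho>" k g a])
      show "connected (ball b e \<inter> ball 0 \<rho>)" by (intro convex_connected convex_Int convex_ball)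
      show "deriv f (k x) \<noteq> 0" if "x \<in> ball b e \<inter> ball 0 \<rho>" for x
        using nz[of "k x" x] k(2,5) that by blast
      show "continuous_on (ball b e \<inter> ball 0 \<rho>) k" "continuous_on (ball b e \<inter> ball 0 \<rho>) g"
        using k(3) g(1) continuous_on_subset by blast+
    qed (use that a k(5) g(2) \<open>k a = g a\<close> in auto)
    then show ?thesis using k by blast
  qed
  then obtain e k where k: "\<And>b::complex. b \<in> sphere 0 \<rho> \<Longrightarrow> 0 < e b \<and> ball b (e b) \<subseteq> ball 0 1 \<and>
      continuous_on (ball b (e b)) (k b) \<and> (\<forall>x\<in>ball b (e b). f (k b x) = h x) \<and>
      (\<forall>x\<in>ball b (e b) \<inter> ball 0 \<rho>. k b x = g x)"
    by metis
  define C where "C = (\<lambda>b. ball b (e b)) ` sphere 0 \<rho>"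
  have "b \<in> \<Union> C" if "b \<in> sphere 0 \<rho>" for b
    using k[OF that] that unfolding C_def by (intro UnionI[of "ball b (e b)"]) auto
  then have cover: "sphere 0 \<rho> \<subseteq> \<Union> C" by blast
  have "open G" if "G \<in> C" for G using that by (auto simp: C_def)
  \<comment> \<open>A Lebesgue number of the cover provides one radius for all local lifts.\<close>
  from Heine_Borel_lemma[OF compact_sphere cover this]
  obtain \<delta> where \<delta>: "0 < \<delta>" "\<And>b. b \<in> sphere 0 \<rho> \<Longrightarrow> \<exists>G\<in>C. ball b \<delta> \<subseteq> G" by metis
  have "\<exists>c. c \<in> sphere 0 \<rho> \<and> ball b \<delta> \<subseteq> ball c (e c)" if "b \<in> sphere 0 \<rho>" for b
    using \<delta>(2)[OF that] unfolding C_def by blast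
  then obtain c where c: "\<And>b. b \<in> sphere 0 \<rho> \<Longrightarrow> c b \<in> sphere 0 \<rho> \<and> ball b \<delta> \<subseteq> ball (c b) (e (c b))"
    by metis
  define kk where "kk b = k (c b)" for b
  have kk: "ball b \<delta> \<subseteq> ball 0 1" "continuous_on (ball b \<delta>) (kk b)"
      "\<And>x. x \<in> ball b \<delta> \<Longrightarrow> f (kk b x) = h x"
      "\<And>x. x \<in> ball b \<delta> \<Longrightarrow> x \<in> ball 0 \<rho> \<Longrightarrow> kk b x = g x" if "b \<in> sphere 0 \<rho>" for b
  proof -
    have sub: "ball b \<delta> \<subseteq> ball (c b) (e (c b))" and cb: "c b \<in> sphere 0 \<rho>" using c[OF that] by auto
    show "ball b \<delta> \<subseteq> ball 0 1" "continuous_on (ball b \<delta>) (kk b)"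
      "\<And>x. x \<in> ball b \<delta> \<Longrightarrow> f (kk b x) = h x"
      "\<And>x. x \<in> ball b \<delta> \<Longrightarrow> x \<in> ball 0 \<rho> \<Longrightarrow> kk b x = g x"
      using k[OF cb] sub continuous_on_subset[of "ball (c b) (e (c b))" "k (c b)"] unfolding kk_def by blast+
  qed
  define \<rho>' where "\<rho>' = min 1 (\<rho> + \<delta>)"
  \<comment> \<open>Outside the old disc the local lift at the radial projection of \<open>x\<close>
    is used.\<close>
  define pr :: "complex \<Rightarrow> complex" where "pr x = of_real \<rho> * sgn x" for x
  define G where "G x = (if x \<in> ball 0 \<rho> then g x else kk (pr x) x)" for x
  have pr: "pr x \<in> sphere 0 \<rho>" "x \<in> ball (pr x) \<delta>" if "x \<in> ball 0 \<rho>'" "x \<notin> ball 0 \<rho>" for x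
  proof -
    have x: "cmod x \<ge> \<rho>" "cmod x < \<rho> + \<delta>" "x \<noteq> 0" using that \<rho> by (auto simp: \<rho>'_def)
    then show "pr x \<in> sphere 0 \<rho>" using \<rho> by (simp add: pr_def norm_mult norm_sgn)
    have "x - pr x = of_real (cmod x - \<rho>) * sgn x"
      using x(3) by (simp add: pr_def algebra_simps sgn_eq)
    then have "cmod (x - pr x) = cmod x - \<rho>" using x by (simp only: norm_mult norm_of_real norm_sgn) simp
    then show "x \<in> ball (pr x) \<delta>" using x by (simp add: dist_norm norm_minus_commute)
  qed
  have "isCont G x" if x: "x \<in> ball 0 \<rho>'" for x
  proof -
    have "\<exists>W u. open W \<and> x \<in> W \<and> continuous_on W u \<and> (\<forall>y\<in>W. G y = u y)"
    proof (cases "x \<in> ball 0 \<rho>")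
      case True
      then show ?thesis using g(1) by (intro exI[of _ "ball 0 \<rho>"] exI[of _ g]) (auto simp: G_def)
    next
      case False
      define b0 where "b0 = pr x"
      have b0: "b0 \<in> sphere 0 \<rho>" "x \<in> ball b0 \<delta>" using pr[OF x False] by (auto simp: b0_def)
      \<comment> \<open>Near \<open>x\<close> the projection stays within \<open>\<delta>\<close> of
        \<open>b0\<close>, and there \<open>G\<close> is shown to coincide with the single lift
        \<open>kk b0\<close>. The origin is removed for the continuity of
        \<open>sgn\<close>.\<close>
      define W where "W = ((ball 0 \<rho>' \<inter> ball b0 \<delta> \<inter> - {0}) \<inter> pr -` ball b0 \<delta>)"
      have "open W" unfolding W_def
        by (rule continuous_open_preimage) (auto simp: pr_def intro!: continuous_intros)
      moreover have "x \<in> W" using x b0 \<delta>(1) False \<rho> by (auto simp: W_def b0_def)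
      moreover have "continuous_on W (kk b0)"
        by (rule continuous_on_subset[OF kk(2)[OF b0(1)]]) (auto simp: W_def)
      moreover have "G y = kk b0 y" if y: "y \<in> W" for y
      proof (cases "y \<in> ball 0 \<rho>")
        case True
        then show ?thesis using kk(4)[OF b0(1), of y] y by (auto simp: G_def W_def)
      next
        case yF: False
        have yb: "y \<in> ball 0 \<rho>'" "y \<in> ball b0 \<delta>" "pr y \<in> ball b0 \<delta>" using y by (auto simp: W_def)
        note p = pr[OF yb(1) yF]
        define I where "I = ball b0 \<delta> \<inter> ball (pr y) \<delta>"
        \<comment> \<open>The overlap of the two balls contains a point of the circle, hence meets
          the old disc, where both local lifts equal \<open>g\<close>.\<close>
        have "pr y \<in> closure (ball 0 \<rho>)" using p(1) \<rho> by simp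
        moreover have "pr y \<in> I" using yb(3) \<delta>(1) by (simp add: I_def)
        moreover have "open I" by (auto simp: I_def)
        ultimately have "I \<inter> ball 0 \<rho> \<noteq> {}" using open_Int_closure_eq_empty by blast
        then obtain a where a: "a \<in> I" "a \<in> ball 0 \<rho>" by blast
        have "kk b0 y = kk (pr y) y"
        proof (rule lift_unique[OF hol, of I "kk b0" "kk (pr y)" a])
          show "connected I" unfolding I_def by (intro convex_connected convex_Int convex_ball)
          show "continuous_on I (kk b0)" "continuous_on I (kk (pr y))"
            using kk(2)[OF b0(1)] kk(2)[OF p(1)] continuous_on_subset unfolding I_def by blast+
          show "f (kk b0 z) = f (kk (pr y) z)" if "z \<in> I" for z
            using kk(3)[OF b0(1), of z] kk(3)[OF p(1), of z] that by (simp add: I_def)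
          show "deriv f (kk b0 z) \<noteq> 0" if "z \<in> I" for z
          proof -
            have "z \<in> ball b0 \<delta>" using that by (simp add: I_def)
            then show ?thesis using nz[OF kk(3)[OF b0(1)]] kk(1)[OF b0(1)] by blast
          qed
          show "kk b0 a = kk (pr y) a"
            using kk(4)[OF b0(1), of a] kk(4)[OF p(1), of a] a by (simp add: I_def)
          show "y \<in> I" using yb p by (simp add: I_def)
        qed (use a in auto)
        then show ?thesis using yF by (simp add: G_def)
      qed
      ultimately show ?thesis by blast
    qed
    then obtain W u where W: "open W" "x \<in> W" "continuous_on W u" "\<And>y. y \<in> W \<Longrightarrow> G y = u y" by blast
    then have "continuous_on W G" using continuous_on_cong by metis
    then show ?thesis using W(1,2) by (simp add: continuous_on_eq_continuous_at)
  qed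
  then have "continuous_on (ball 0 \<rho>') G" by (simp add: continuous_at_imp_continuous_on)
  moreover have "f (G x) = h x" if "x \<in> ball 0 \<rho>'" for x
    using pr[OF that] kk(3)[of "pr x" x] g(2) by (auto simp: G_def)
  moreover have "G 0 = g 0" using \<rho> by (simp add: G_def)
  moreover have "\<rho> < \<rho>'" "\<rho>' \<le> 1" using \<rho> \<delta>(1) by (auto simp: \<rho>'_def)
  ultimately show thesis using that by blast
qed

text \<open>Lifts on smaller discs agree by uniqueness and glue to a lift on the disc of the
  supremal radius \<open>s\<close>; by \<open>disc_lift_extend\<close> this radius cannot be less
  than 1.\<close>

lemma disc_lift:
  fixes h :: "complex \<Rightarrow> complex"
  assumes hol: "f holomorphic_on UNIV" and h: "continuous_on (ball 0 1) h"
    and reg: "\<And>x. x \<in> ball 0 1 \<Longrightarrow> h x \<notin> critical_values f \<union> asymptotic_values f"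
    and z0: "f z0 = h 0"
  obtains g where "continuous_on (ball 0 1) g" "\<And>x. x \<in> ball 0 1 \<Longrightarrow> f (g x) = h x" "g 0 = z0"
proof -
  have nz: "deriv f z \<noteq> 0" if "f z = h x" "x \<in> ball 0 1" for z x
  proof
    assume "deriv f z = 0"
    then have "f z \<in> critical_values f" by (auto simp: critical_values_def)
    then show False using reg[OF that(2)] that(1) by simp
  qed
  define P where "P \<rho> g \<longleftrightarrow> continuous_on (ball 0 \<rho>) g \<and> (\<forall>x\<in>ball 0 \<rho>. f (g x) = h x) \<and> g 0 = z0"
    for \<rho> :: real and g :: "complex \<Rightarrow> complex"
  define X where "X = {\<rho>. 0 < \<rho> \<and> \<rho> \<le> 1 \<and> (\<exists>g. P \<rho> g)}"
  have "\<exists>\<rho>. \<rho> \<in> X"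
  proof -
    have "(0::complex) \<in> ball 0 1" by simp
    from local_lift[OF hol nz[OF z0 this] z0 open_ball this h]
    obtain e k where k: "0 < e" "ball 0 e \<subseteq> ball (0::complex) 1" "continuous_on (ball 0 e) k" "k 0 = z0"
      "\<And>x. x \<in> ball 0 e \<Longrightarrow> f (k x) = h x" by metis
    have "ball (0::complex) (min e 1) \<subseteq> ball 0 e" by auto
    then have "P (min e 1) k" unfolding P_def
      using k continuous_on_subset[OF k(3)] by blast
    then have "min e 1 \<in> X" using k(1) by (auto simp: X_def)
    then show ?thesis by blast
  qed
  then have ne: "X \<noteq> {}" by blast
  have bdd: "bdd_above X" by (intro bdd_aboveI[of _ 1]) (auto simp: X_def)
  define s where "s = Sup X"
  have s: "0 < s" "s \<le> 1"
  proof -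
    obtain \<rho> where "\<rho> \<in> X" using ne by blast
    then show "0 < s" using cSup_upper[OF _ bdd, of \<rho>] by (auto simp: s_def X_def)
    show "s \<le> 1" unfolding s_def using ne by (intro cSup_least) (auto simp: X_def)
  qed
  have "\<exists>g. P \<rho> g" if \<rho>: "0 < \<rho>" "\<rho> < s" for \<rho>
  proof -
    obtain \<rho>' where r: "\<rho>' \<in> X" "\<rho> < \<rho>'" using \<rho> less_cSup_iff[OF ne bdd] by (auto simp: s_def)
    then obtain g where g: "P \<rho>' g" by (auto simp: X_def)
    have "ball (0::complex) \<rho> \<subseteq> ball 0 \<rho>'" using r(2) by auto
    then have "P \<rho> g" using g continuous_on_subset[of "ball 0 \<rho>'" g "ball 0 \<rho>"] unfolding P_def by blast
    then show ?thesis by blast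
  qed
  then obtain gg where gg: "\<And>\<rho>. 0 < \<rho> \<Longrightarrow> \<rho> < s \<Longrightarrow> P \<rho> (gg \<rho>)" by metis
  have agree: "gg \<rho> x = gg \<rho>' x" if "x \<in> ball 0 \<rho>" "x \<in> ball 0 \<rho>'" "\<rho> < s" "\<rho>' < s" for \<rho> \<rho>' and x :: complex
  proof -
    have pos: "0 < \<rho>" "0 < \<rho>'" using that norm_ge_zero[of x] unfolding mem_ball_0 by linarith+
    note g1 = gg[OF pos(1) that(3)] and g2 = gg[OF pos(2) that(4)]
    define m where "m = min \<rho> \<rho>'"
    have m: "ball (0::complex) m \<subseteq> ball 0 \<rho>" "ball (0::complex) m \<subseteq> ball 0 \<rho>'" "0 < m" using pos by (auto simp: m_def)
    show ?thesis
    proof (rule lift_unique[OF hol, of "ball 0 m" "gg \<rho>" "gg \<rho>'" 0])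
      show "continuous_on (ball 0 m) (gg \<rho>)" "continuous_on (ball 0 m) (gg \<rho>')"
        using g1 g2 m continuous_on_subset unfolding P_def by blast+
      show "f (gg \<rho> y) = f (gg \<rho>' y)" if "y \<in> ball 0 m" for y
        using g1 g2 m that unfolding P_def by (metis subsetD)
      show "deriv f (gg \<rho> y) \<noteq> 0" if y: "y \<in> ball 0 m" for y
      proof (rule nz)
        show "f (gg \<rho> y) = h y" using g1 m y unfolding P_def by blast
        show "y \<in> ball 0 1" using y \<open>\<rho> < s\<close> s by (simp add: m_def)
      qed
      show "gg \<rho> 0 = gg \<rho>' 0" using g1 g2 by (simp add: P_def)
    qed (use that m in \<open>auto simp: m_def\<close>)
  qed
  \<comment> \<open>The midpoint lies strictly between \<open>cmod x\<close> and \<open>s\<close>,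
    so it selects a lift defined at \<open>x\<close>.\<close>
  define G where "G x = gg ((cmod x + s) / 2) x" for x
  have Gg: "G x = gg \<rho> x" if "x \<in> ball 0 \<rho>" "\<rho> < s" for x \<rho>
    unfolding G_def using that by (intro agree) auto
  have "P s G" unfolding P_def
  proof (intro conjI ballI)
    have in_half: "x \<in> ball 0 ((cmod x + s) / 2)" "(cmod x + s) / 2 < s" "0 < (cmod x + s) / 2" if "x \<in> ball 0 s" for x
      using that s by (auto simp: add_nonneg_pos)
    show "continuous_on (ball 0 s) G"
    proof (rule continuous_at_imp_continuous_on, intro ballI)
      fix x :: complex assume x: "x \<in> ball 0 s"
      let ?\<rho> = "(cmod x + s) / 2"
      have "continuous_on (ball 0 ?\<rho>) (gg ?\<rho>)" using gg[OF in_half(3,2)[OF x]] by (simp add: P_def)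
      moreover have "continuous_on (ball 0 ?\<rho>) G \<longleftrightarrow> continuous_on (ball 0 ?\<rho>) (gg ?\<rho>)"
        using Gg[OF _ in_half(2)[OF x]] by (intro continuous_on_cong refl) blast
      ultimately have "continuous_on (ball 0 ?\<rho>) G" by blast
      then show "isCont G x" using in_half(1)[OF x] by (simp add: continuous_on_eq_continuous_at)
    qed
    show "f (G x) = h x" if x: "x \<in> ball 0 s" for x
      using Gg[OF in_half(1,2)[OF x]] gg[OF in_half(3,2)[OF x]] in_half(1)[OF x] by (simp add: P_def)
    show "G 0 = z0" using gg[of "s / 2"] s by (simp add: G_def P_def)
  qed
  have "s = 1"
  proof (rule ccontr)
    assume "s \<noteq> 1"
    then have "s < 1" using s by simp
    from \<open>P s G\<close> have G: "continuous_on (ball 0 s) G" "\<And>x. x \<in> ball 0 s \<Longrightarrow> f (G x) = h x" "G 0 = z0"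
      by (auto simp: P_def)
    obtain \<rho>' G' where "s < \<rho>'" "\<rho>' \<le> 1" "continuous_on (ball 0 \<rho>') G'"
      "\<And>x. x \<in> ball 0 \<rho>' \<Longrightarrow> f (G' x) = h x" "G' 0 = G 0"
      using disc_lift_extend[OF hol h reg s(1) \<open>s < 1\<close> G(1,2)] by metis
    then have "\<rho>' \<in> X" using s(1) G(3) unfolding X_def P_def by auto
    then show False using cSup_upper[OF _ bdd, of \<rho>'] \<open>s < \<rho>'\<close> by (simp add: s_def)
  qed
  with \<open>P s G\<close> have "P 1 G" by simp
  then show thesis using that unfolding P_def by blast
qed

text \<open>The Cayley maps \<open>\<phi>\<close> and \<open>\<psi>\<close> identify the half-plane
  with the unit disc, taking \<open>w0\<close> to 0, and on the half-plane \<open>exp\<close> avoids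
  the singular values. Here \<open>p\<close> is the foot of \<open>w0\<close> on the boundary line
  and \<open>c\<close> its distance from it.\<close>

lemma half_plane_lift:
  assumes hol: "f holomorphic_on UNIV"
    and reg: "\<And>w. w \<in> critical_values f \<union> asymptotic_values f \<Longrightarrow> cmod w \<le> exp L"
    and w0: "L < Re w0" "f z0 = exp w0"
  obtains G where "continuous_on {w. L < Re w} G" "\<And>w. L < Re w \<Longrightarrow> f (G w) = exp w" "G w0 = z0"
proof -
  define c where "c = Re w0 - L"
  have c: "0 < c" using w0 by (simp add: c_def)
  define p where "p = Complex L (Im w0)"
  define \<psi> where "\<psi> x = p + of_real c * ((1 + x) / (1 - x))" for x
  define \<phi> where "\<phi> w = (w - p - of_real c) / (w - p + of_real c)" for w
  have \<psi>: "L < Re (\<psi> x)" if "cmod x < 1" for x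
  proof -
    have "x \<noteq> 1" using that by auto
    have "(1 + x) / (1 - x) = (1 + x) * cnj (1 - x) / of_real ((cmod (1 - x))\<^sup>2)"
      using complex_div_cnj[of "1 + x" "1 - x"] by simp
    then have "Re ((1 + x) / (1 - x)) = Re ((1 + x) * cnj (1 - x)) / (cmod (1 - x))\<^sup>2"
      by (simp only: Re_divide_of_real)
    also have "Re ((1 + x) * cnj (1 - x)) = 1 - (cmod x)\<^sup>2"
      unfolding cmod_power2 by (simp add: algebra_simps power2_eq_square)
    finally have "Re ((1 + x) / (1 - x)) = (1 - (cmod x)\<^sup>2) / (cmod (1 - x))\<^sup>2" .
    moreover have "0 < (1 - (cmod x)\<^sup>2) / (cmod (1 - x))\<^sup>2"
      using that \<open>x \<noteq> 1\<close> by (simp add: power_less_one_iff)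
    moreover have "Re (of_real c * y) = c * Re y" for y by simp
    ultimately have "0 < Re (of_real c * ((1 + x) / (1 - x)))" using c by (simp only: mult_pos_pos)
    then show ?thesis by (simp add: \<psi>_def p_def)
  qed
  have \<phi>: "w - p + of_real c \<noteq> 0" "cmod (\<phi> w) < 1" "\<psi> (\<phi> w) = w" if "L < Re w" for w
  proof -
    have Re: "0 < Re (w - p)" using that by (simp add: p_def)
    then show nz: "w - p + of_real c \<noteq> 0" using c by (auto simp: complex_eq_iff)
    have "(Re (w - p) - c)\<^sup>2 < (Re (w - p) + c)\<^sup>2"
    proof -
      have "(Re (w - p) + c)\<^sup>2 - (Re (w - p) - c)\<^sup>2 = 4 * Re (w - p) * c" by (simp add: power2_eq_square algebra_simps)
      moreover have "4 * Re (w - p) * c > 0" using Re c by simp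
      ultimately show ?thesis by linarith
    qed
    then have "cmod (w - p - of_real c) < cmod (w - p + of_real c)"
      unfolding cmod_def by (intro real_sqrt_less_mono) simp
    then show "cmod (\<phi> w) < 1" using nz by (simp add: \<phi>_def norm_divide)
    have eqs: "1 - \<phi> w = 2 * of_real c / (w - p + of_real c)" "1 + \<phi> w = 2 * (w - p) / (w - p + of_real c)"
      using nz by (simp_all add: \<phi>_def field_simps)
    have "(2 * A / D) / (2 * C / D) = A / C" if "D \<noteq> 0" for A C D :: complex using that by simp
    from this[OF nz] have "(1 + \<phi> w) / (1 - \<phi> w) = (w - p) / of_real c" unfolding eqs .
    then have "\<psi> (\<phi> w) = p + of_real c * ((w - p) / of_real c)" by (simp only: \<psi>_def)
    then show "\<psi> (\<phi> w) = w" using c by simp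
  qed
  have \<psi>0: "\<psi> 0 = w0" by (simp add: \<psi>_def p_def c_def complex_eq_iff)
  have "\<phi> w0 = 0" by (simp add: \<phi>_def p_def c_def complex_eq_iff Re_divide Im_divide)
  have "continuous_on (ball 0 1) (\<lambda>x. exp (\<psi> x))"
    unfolding \<psi>_def by (intro continuous_intros) auto
  moreover have "exp (\<psi> x) \<notin> critical_values f \<union> asymptotic_values f" if "x \<in> ball 0 1" for x
    using reg[of "exp (\<psi> x)"] \<psi>[of x] that by auto
  moreover have "f z0 = exp (\<psi> 0)" using \<psi>0 w0 by simp
  ultimately obtain g where g: "continuous_on (ball 0 1) g" "\<And>x. x \<in> ball 0 1 \<Longrightarrow> f (g x) = exp (\<psi> x)" "g 0 = z0"
    using disc_lift[OF hol, of "\<lambda>x. exp (\<psi> x)" z0] by metis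
  show thesis
  proof (rule that[of "\<lambda>w. g (\<phi> w)"])
    have "continuous_on {w. L < Re w} \<phi>" unfolding \<phi>_def using \<phi>(1) by (intro continuous_intros) auto
    then show "continuous_on {w. L < Re w} (\<lambda>w. g (\<phi> w))"
      by (rule continuous_on_compose2[OF g(1)]) (use \<phi>(2) in auto)
    show "f (g (\<phi> w)) = exp w" if "L < Re w" for w using g(2)[of "\<phi> w"] \<phi>[OF that] by simp
    show "g (\<phi> w0) = z0" using g(3) \<open>\<phi> w0 = 0\<close> by simp
  qed
qed

subsection \<open>The Eremenko--Lyubich class\<close>

lemma polynomial_if_tends_to_infinity:
  assumes hol: "f holomorphic_on UNIV" and inf: "filterlim f at_infinity at_infinity"
  shows "\<exists>p. \<forall>z. f z = poly p z"
proof -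
  have "((inverse \<circ> f) \<longlongrightarrow> 0) at_infinity"
    using filterlim_compose[OF tendsto_inverse_0 inf] by (simp add: o_def)
  then obtain a n where a: "\<And>z. f z = (\<Sum>i\<le>n. a i * z ^ i)" using pole_at_infinity[OF hol] by metis
  have "f z = poly (\<Sum>i\<le>n. monom (a i) i) z" for z by (simp add: a poly_sum poly_monom)
  then show ?thesis by blast
qed

lemma circle_meets_sublevel_set:
  assumes f: "transcendental_entire f"
    and reg: "\<And>w. w \<in> critical_values f \<union> asymptotic_values f \<Longrightarrow> cmod w \<le> exp L"
    and f0: "cmod (f 0) \<le> exp L" and r: "0 < r"
  shows "\<exists>z. cmod z = r \<and> cmod (f z) \<le> exp L"
proof (rule ccontr)
  assume "\<not> ?thesis"
  then have big: "exp L < cmod (f z)" if "cmod z = r" for z using that by force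
  have hol: "f holomorphic_on UNIV" using f by (simp add: transcendental_entire_def)
  have contf: "continuous_on S f" for S using hol by (rule entire_continuous_on)
  have nz: "deriv f z \<noteq> 0" if "exp L < cmod (f z)" for z
  proof
    assume "deriv f z = 0"
    then have "f z \<in> critical_values f" by (auto simp: critical_values_def)
    then show False using reg[of "f z"] that by simp
  qed

  \<comment> \<open>Lifting \<open>exp\<close> along the circle\<close>
  define H where "H = {w. L < Re w}"
  have H: "convex H" unfolding H_def by (rule convex_halfspace_Re_gt)
  define I where "I = {0..2 * pi}"
  define \<kappa> where "\<kappa> \<theta> = of_real r * exp (\<i> * of_real \<theta>)" for \<theta> :: real
  have \<kappa>r: "cmod (\<kappa> \<theta>) = r" for \<theta> using r by (simp add: \<kappa>_def norm_mult)
  have \<kappa>c: "continuous_on I \<kappa>" unfolding \<kappa>_def by (intro continuous_intros)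
  have "continuous_on I (\<lambda>\<theta>. f (\<kappa> \<theta>))" by (rule continuous_on_compose2[OF contf \<kappa>c]) auto
  moreover have "contractible I" unfolding I_def by (intro convex_imp_contractible) simp
  moreover have "f (\<kappa> \<theta>) \<noteq> 0" for \<theta> using big[OF \<kappa>r[of \<theta>]] by (smt (verit) exp_gt_zero norm_zero)
  ultimately obtain q where q: "continuous_on I q" "\<And>\<theta>. \<theta> \<in> I \<Longrightarrow> f (\<kappa> \<theta>) = exp (q \<theta>)"
    using continuous_logarithm_on_contractible[of I "\<lambda>\<theta>. f (\<kappa> \<theta>)"] by metis
  have qH: "q \<theta> \<in> H" if "\<theta> \<in> I" for \<theta>
    using big[OF \<kappa>r[of \<theta>]] q(2)[OF that] by (simp add: H_def)
  have I0: "0 \<in> I" and I2: "2 * pi \<in> I" by (auto simp: I_def)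
  obtain G where G: "continuous_on H G" "\<And>w. w \<in> H \<Longrightarrow> f (G w) = exp w" "G (q 0) = \<kappa> 0"
    using half_plane_lift[where ?w0.0 = "q 0" and ?z0.0 = "\<kappa> 0", OF hol reg] qH[OF I0] q(2)[OF I0] unfolding H_def by auto
  have Gbig: "exp L < cmod (f (G w))" if "w \<in> H" for w using G(2)[OF that] that by (simp add: H_def)
  have Gq: "G (q \<theta>) = \<kappa> \<theta>" if "\<theta> \<in> I" for \<theta>
  proof (rule lift_unique[OF hol, of I "\<lambda>\<theta>. G (q \<theta>)" \<kappa> 0])
    show "continuous_on I (\<lambda>\<theta>. G (q \<theta>))" by (rule continuous_on_compose2[OF G(1) q(1)]) (use qH in auto)
    show "connected I" by (simp add: I_def)
    show "f (G (q \<theta>)) = f (\<kappa> \<theta>)" if "\<theta> \<in> I" for \<theta> using G(2)[OF qH[OF that]] q(2)[OF that] by simp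
    show "deriv f (G (q \<theta>)) \<noteq> 0" if "\<theta> \<in> I" for \<theta> using nz Gbig qH that by blast
  qed (use I0 G \<kappa>c that in auto)
  \<comment> \<open>The value at 0 is too small to be attained by \<open>f\<close> on the range of
    \<open>G\<close>. Hence \<open>G\<close> omits 0 and has a logarithm, which records the winding
    around the circle.\<close>
  have "\<And>w. w \<in> H \<Longrightarrow> G w \<noteq> 0" using Gbig f0 by force
  then obtain l where l: "continuous_on H l" "\<And>w. w \<in> H \<Longrightarrow> G w = exp (l w)"
    using continuous_logarithm_on_contractible[OF G(1) convex_imp_contractible[OF H]] by metis
  \<comment> \<open>Uniqueness of lifts is applied to \<open>exp\<close> itself. At the end of the
    circuit \<open>l\<close> has changed by \<open>2 * pi * \<i>\<close>, so \<open>q\<close> cannot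
    have returned to its initial value.\<close>
  have "l (q \<theta>) = l (q 0) + \<i> * of_real \<theta>" if "\<theta> \<in> I" for \<theta>
  proof (rule lift_unique[of exp I "\<lambda>\<theta>. l (q \<theta>)" "\<lambda>\<theta>. l (q 0) + \<i> * of_real \<theta>" 0])
    show "continuous_on I (\<lambda>\<theta>. l (q \<theta>))" by (rule continuous_on_compose2[OF l(1) q(1)]) (use qH in auto)
    show "connected I" by (simp add: I_def)
    show "exp (l (q \<theta>)) = exp (l (q 0) + \<i> * of_real \<theta>)" if "\<theta> \<in> I" for \<theta>
      using l(2)[OF qH[OF that]] l(2)[OF qH[OF I0]] Gq[OF that] Gq[OF I0] by (simp add: exp_add \<kappa>_def)
    show "continuous_on I (\<lambda>\<theta>. l (q 0) + \<i> * of_real \<theta>)" by (intro continuous_intros)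
    show "deriv exp (l (q \<theta>)) \<noteq> (0::complex)" for \<theta> by (simp add: DERIV_imp_deriv[OF DERIV_exp])
  qed (use I0 that in \<open>auto intro!: holomorphic_intros\<close>)
  from this[OF I2] have ne: "q (2 * pi) \<noteq> q 0" by auto

  \<comment> \<open>The period of the lift\<close>
  have \<kappa>2: "\<kappa> (2 * pi) = \<kappa> 0" using exp_two_pi_i by (simp add: \<kappa>_def mult.commute mult.left_commute)
  then have "exp (q (2 * pi)) = exp (q 0)" using q(2)[OF I0] q(2)[OF I2] by simp
  then obtain n :: int where n: "q (2 * pi) = q 0 + of_int (2 * n) * pi * \<i>" unfolding exp_eq by blast
  define P where "P = 2 * pi * \<bar>of_int n\<bar>"
  have "n \<noteq> 0" using n ne by auto
  then have P: "0 < P" by (simp add: P_def)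
  have per: "G (w + of_real (2 * pi * of_int n) * \<i>) = G w" if "w \<in> H" for w
  proof (rule lift_unique[OF hol, of H "\<lambda>w. G (w + of_real (2 * pi * of_int n) * \<i>)" G "q 0"])
    have inH: "w + of_real (2 * pi * of_int n) * \<i> \<in> H" if "w \<in> H" for w using that by (simp add: H_def)
    show "continuous_on H (\<lambda>w. G (w + of_real (2 * pi * of_int n) * \<i>))"
      by (rule continuous_on_compose2[OF G(1)]) (use inH in \<open>auto intro!: continuous_intros\<close>)
    show "f (G (w + of_real (2 * pi * of_int n) * \<i>)) = f (G w)" if "w \<in> H" for w
      unfolding G(2)[OF that] G(2)[OF inH[OF that]] exp_eq by (intro exI[of _ n]) simp
    show "deriv f (G (w + of_real (2 * pi * of_int n) * \<i>)) \<noteq> 0" if "w \<in> H" for w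
      using nz Gbig inH that by blast
    show "G (q 0 + of_real (2 * pi * of_int n) * \<i>) = G (q 0)"
      using n Gq[OF I0] Gq[OF I2] \<kappa>2 by (simp add: mult.commute mult.left_commute)
  qed (use that G(1) convex_connected[OF H] qH[OF I0] in auto)
  have perP: "G (w + of_real P * \<i>) = G w" if "w \<in> H" for w
  proof (cases "n \<ge> 0")
    case True
    then show ?thesis using per[OF that] by (simp add: P_def)
  next
    case False
    have "w + of_real P * \<i> \<in> H" using that by (simp add: H_def)
    from per[OF this] show ?thesis using False by (simp add: P_def)
  qed
  have periodic: "G (w + of_real (of_int k * P) * \<i>) = G w" if "w \<in> H" for w and k :: int
  proof (induction k rule: int_induct[where k=0])
    case (step1 i)
    have "w + of_real (of_int i * P) * \<i> \<in> H" using that by (simp add: H_def)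
    from perP[OF this] step1 show ?case by (simp add: algebra_simps)
  next
    case (step2 i)
    have "w + of_real (of_int (i - 1) * P) * \<i> \<in> H" using that by (simp add: H_def)
    from perP[OF this] step2 show ?case by (simp add: algebra_simps)
  qed simp
  have reduce: "\<exists>v\<in>H. Re v = Re w \<and> 0 \<le> Im v \<and> Im v \<le> P \<and> G v = G w" if "w \<in> H" for w
  proof -
    define k where "k = - \<lfloor>Im w / P\<rfloor>"
    define v where "v = w + of_real (of_int k * P) * \<i>"
    have "of_int (- k) \<le> Im w / P" "Im w / P \<le> of_int (- k) + 1" unfolding k_def by linarith+
    then have "0 \<le> Im v" "Im v \<le> P" using P by (auto simp: v_def field_simps)
    then show ?thesis using that periodic[OF that, of k] by (intro bexI[of _ v]) (auto simp: v_def H_def)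
  qed

  \<comment> \<open>The lift covers a neighbourhood of infinity\<close>
  have outer: "\<exists>\<rho>. \<forall>z. \<rho> \<le> cmod z \<longrightarrow> exp B < cmod (f z)" if B: "L < B" for B
  proof -
    \<comment> \<open>One period of the boundary line \<open>Re w = B\<close> suffices, so its image
      is compact and a large disc contains it. Outside that disc \<open>\<Omega>\<close> is
      relatively open and closed.\<close>
    define K where "K = G ` cbox (Complex B 0) (Complex B P)"
    have sub: "cbox (Complex B 0) (Complex C P) \<subseteq> H" for C using B by (auto simp: H_def in_cbox_complex_iff)
    have "compact K" unfolding K_def
      by (intro compact_continuous_image continuous_on_subset[OF G(1) sub] compact_cbox)
    then obtain \<rho> where \<rho>: "K \<subseteq> ball 0 \<rho>" using bounded_subset_ballD[OF compact_imp_bounded, of K 0] by blast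
    define \<Omega> where "\<Omega> = G ` {w. B < Re w}"
    define Y where "Y = - ball (0::complex) \<rho>"
    have inH: "w \<in> H" if "B < Re w" for w using that B by (simp add: H_def)
    have "open \<Omega>" unfolding open_contains_ball
    proof
      fix z assume "z \<in> \<Omega>"
      then obtain w where w: "B < Re w" "z = G w" by (auto simp: \<Omega>_def)
      have fz: "f z = exp w" using G(2)[OF inH[OF w(1)]] w(2) by simp
      have "open (UNIV \<inter> (\<lambda>z. cmod (f z)) -` {exp B<..})"
        by (intro continuous_open_preimage continuous_on_norm contf open_UNIV open_greaterThan)
      moreover have "z \<in> UNIV \<inter> (\<lambda>z. cmod (f z)) -` {exp B<..}" using fz w by simp
      ultimately obtain e where e: "0 < e" "ball z e \<subseteq> UNIV \<inter> (\<lambda>z. cmod (f z)) -` {exp B<..}"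
        using open_contains_ball by blast
      then have fB: "exp B < cmod (f u)" if "u \<in> ball z e" for u using that by blast
      then have "f u \<noteq> 0" if "u \<in> ball z e" for u using that by force
      then obtain m where m: "continuous_on (ball z e) m" "\<And>u. u \<in> ball z e \<Longrightarrow> f u = exp (m u)"
        using continuous_logarithm_on_contractible[OF contf convex_imp_contractible[OF convex_ball]] by metis
      \<comment> \<open>The branch of the logarithm of \<open>f\<close> is shifted to take the value
        \<open>w\<close> at \<open>z\<close>; following it by \<open>G\<close> gives back the
        identity near \<open>z\<close>.\<close>
      define m' where "m' u = m u - m z + w" for u
      have zin: "z \<in> ball z e" using e(1) by simp
      have m'1: "exp (m' u) = f u" if "u \<in> ball z e" for u
        using m(2)[OF that] m(2)[OF zin] fz by (simp add: m'_def exp_add exp_diff)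
      have m'2: "B < Re (m' u)" if "u \<in> ball z e" for u
        using fB[OF that] unfolding m'1[OF that, symmetric] by simp
      have "u = G (m' u)" if "u \<in> ball z e" for u
      proof (rule lift_unique[OF hol, of "ball z e" "\<lambda>u. u" "\<lambda>u. G (m' u)" z])
        have "continuous_on (ball z e) m'" unfolding m'_def by (intro continuous_intros m(1))
        then show "continuous_on (ball z e) (\<lambda>u. G (m' u))"
          by (rule continuous_on_compose2[OF G(1)]) (use m'2 inH in auto)
        show "f u = f (G (m' u))" if "u \<in> ball z e" for u
          using m'1[OF that] G(2)[OF inH[OF m'2[OF that]]] by simp
        show "deriv f u \<noteq> 0" if "u \<in> ball z e" for u
          using fB[OF that] B by (intro nz) (meson exp_less_mono less_trans)
        show "z = G (m' z)" using w by (simp add: m'_def)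
      qed (use that zin in auto)
      then have "ball z e \<subseteq> \<Omega>" using m'2 unfolding \<Omega>_def by blast
      then show "\<exists>e>0. ball z e \<subseteq> \<Omega>" using e(1) by blast
    qed
    have "z \<in> \<Omega>" if z: "z \<in> Y" "z \<in> closure \<Omega>" for z
    proof -
      obtain x where x: "\<And>n::nat. x n \<in> \<Omega>" "x \<longlonglongrightarrow> z" using z(2) closure_sequential by metis
      \<comment> \<open>Preimages are moved into one period strip; their real parts are bounded
        because \<open>f (x n)\<close> converges, so a subsequence of them converges too.\<close>
      have "\<exists>v. B < Re v \<and> 0 \<le> Im v \<and> Im v \<le> P \<and> G v = x n" for n
      proof -
        obtain w where w: "B < Re w" "x n = G w" using x(1)[of n] by (auto simp: \<Omega>_def)
        then show ?thesis using reduce[OF inH[OF w(1)]] by metis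
      qed
      then obtain v where v: "\<And>n. B < Re (v n)" "\<And>n. 0 \<le> Im (v n)" "\<And>n. Im (v n) \<le> P" "\<And>n. G (v n) = x n"
        by metis
      have "isCont f z" using contf[of UNIV] continuous_on_eq_continuous_at[OF open_UNIV] by blast
      then have "convergent (\<lambda>n. f (x n))" using isCont_tendsto_compose[OF _ x(2)] by (auto simp: convergent_def)
      then obtain C where C: "\<And>n. cmod (f (x n)) \<le> C" using convergent_imp_Bseq Bseq_def by metis
      have vC: "Re (v n) \<le> C" for n
      proof -
        have "exp (Re (v n)) \<le> C" using C[of n] G(2)[OF inH[OF v(1)]] v(4)[of n] by (metis norm_exp_eq_Re)
        then show ?thesis using exp_ge_add_one_self[of "Re (v n)"] by linarith
      qed
      have "seq_compact (cbox (Complex B 0) (Complex C P))" using compact_cbox compact_imp_seq_compact by blast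
      moreover have "\<forall>n. v n \<in> cbox (Complex B 0) (Complex C P)"
        using v vC by (auto simp: in_cbox_complex_iff less_imp_le)
      ultimately obtain u \<sigma> where u: "u \<in> cbox (Complex B 0) (Complex C P)" "strict_mono (\<sigma> :: nat \<Rightarrow> nat)" "(v \<circ> \<sigma>) \<longlonglongrightarrow> u"
        by (rule seq_compactE)
      have "(\<lambda>n. G ((v \<circ> \<sigma>) n)) \<longlonglongrightarrow> G u"
        by (rule continuous_on_tendsto_compose[OF G(1) u(3)]) (use u(1) sub inH v(1) in auto)
      moreover have "(\<lambda>n. G ((v \<circ> \<sigma>) n)) \<longlonglongrightarrow> z"
        using LIMSEQ_subseq_LIMSEQ[OF x(2) u(2)] v(4) by (simp add: o_def)
      ultimately have zu: "z = G u" using LIMSEQ_unique by blast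
      have "z \<notin> K" using z(1) \<rho> by (auto simp: Y_def)
      then have "Re u \<noteq> B" using u(1) zu by (auto simp: K_def in_cbox_complex_iff)
      then have "B < Re u" using u(1) by (auto simp: in_cbox_complex_iff)
      then show ?thesis using zu by (auto simp: \<Omega>_def)
    qed
    then have "Y \<inter> \<Omega> = Y \<inter> closure \<Omega>" using closure_subset by blast
    then have "closedin (top_of_set Y) (Y \<inter> \<Omega>)" by (simp add: closedin_closed_Int)
    moreover have "openin (top_of_set Y) (Y \<inter> \<Omega>)" using \<open>open \<Omega>\<close> by (simp add: openin_open_Int)
    moreover have "connected Y" unfolding Y_def
      by (rule connected_complement_bounded_convex) auto
    moreover have "Y \<inter> \<Omega> \<noteq> {}"
    proof -
      have "compact (f ` cball 0 \<rho>)" by (intro compact_continuous_image contf compact_cball)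
      then obtain C where C: "\<And>z. z \<in> cball 0 \<rho> \<Longrightarrow> cmod (f z) \<le> C"
        using compact_imp_bounded bounded_iff by (metis imageI)
      define w where "w = complex_of_real (max (B + 1) C)"
      have w: "B < Re w" "C \<le> Re w" by (auto simp: w_def)
      have "cmod (f (G w)) = exp (Re w)" using G(2)[OF inH[OF w(1)]] by simp
      then have "C < cmod (f (G w))" using w(2) exp_ge_add_one_self[of "Re w"] by linarith
      then have "G w \<notin> cball 0 \<rho>" using C[of "G w"] by linarith
      then have "G w \<in> Y" by (simp add: Y_def)
      then show ?thesis using w(1) by (auto simp: \<Omega>_def)
    qed
    ultimately have "Y \<inter> \<Omega> = Y" unfolding connected_clopen by blast
    then have "exp B < cmod (f z)" if "\<rho> \<le> cmod z" for z
    proof -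
      have "z \<in> Y" using that by (simp add: Y_def)
      then obtain w where "B < Re w" "z = G w" using \<open>Y \<inter> \<Omega> = Y\<close> unfolding \<Omega>_def by blast
      then show ?thesis using G(2)[OF inH] by simp
    qed
    then show ?thesis by blast
  qed
  have "filterlim f at_infinity at_infinity"
    unfolding filterlim_at_infinity[OF order_refl] eventually_at_infinity
  proof (intro allI impI)
    fix s :: real assume "0 < s"
    obtain \<rho> where \<rho>: "\<And>z. \<rho> \<le> cmod z \<Longrightarrow> exp (max (L + 1) (ln s)) < cmod (f z)"
      using outer[of "max (L + 1) (ln s)"] by (metis less_add_one less_max_iff_disj)
    have "s \<le> exp (max (L + 1) (ln s))" using \<open>0 < s\<close> by (metis exp_le_cancel_iff exp_ln max.cobounded2)
    then show "\<exists>b. \<forall>x. b \<le> cmod x \<longrightarrow> s \<le> cmod (f x)" using \<rho> by (meson less_imp_le order_trans)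
  qed
  then show False using polynomial_if_tends_to_infinity[OF hol] f by (auto simp: transcendental_entire_def)
qed

lemma min_modulus_bounded_if_eremenko_lyubich:
  assumes "f \<in> eremenko_lyubich_class"
  obtains L where "\<And>r. 0 < r \<Longrightarrow> min_modulus f r \<le> exp L"
proof -
  have f: "transcendental_entire f" "bounded (critical_values f \<union> asymptotic_values f)"
    using assms by (auto simp: eremenko_lyubich_class_def)
  then obtain b where b: "\<And>w. w \<in> critical_values f \<union> asymptotic_values f \<Longrightarrow> cmod w \<le> b"
    unfolding bounded_iff by blast
  \<comment> \<open>Since \<open>L \<le> exp L\<close>, the number \<open>exp L\<close> bounds the
    singular values as well as \<open>f 0\<close>.\<close>
  define L where "L = max b (cmod (f 0))"
  have "L \<le> exp L" using exp_ge_add_one_self[of L] by linarith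
  then have "\<exists>z. cmod z = r \<and> cmod (f z) \<le> exp L" if "0 < r" for r
    using circle_meets_sublevel_set[OF f(1) _ _ that, of L] b unfolding L_def
    by (meson max.cobounded1 max.cobounded2 order_trans)
  then show thesis using that[of L] min_modulus_le by (metis order_trans)
qed

theorem theorem5p1:
  fixes K :: real
  assumes "K = 4 * ln 4"
  shows "(\<forall>f. transcendental_entire f \<and>
            (\<exists>R>1. \<forall>r\<ge>R. min_modulus f r \<le> max_modulus f r powr (1 - K / ln r))
              \<longrightarrow> log_regular f) \<and>
         (\<forall>f. f \<in> eremenko_lyubich_class \<longrightarrow> log_regular f)"
proof (intro conjI allI impI)
  have "2 * ln (2::real) = ln 4" using ln_realpow[of 2 2] by simp
  moreover have "1 / 2 \<le> ln (2::real)" using ln_le_minus_one[of "1 / 2 :: real"] by (simp add: ln_div)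
  ultimately have K: "2 \<le> K" using assms by simp
  show "log_regular f" if "transcendental_entire f \<and>
    (\<exists>R>1. \<forall>r\<ge>R. min_modulus f r \<le> max_modulus f r powr (1 - K / ln r))" for f
    using log_regular_if_min_modulus_small[OF K] that by blast
  fix f assume f: "f \<in> eremenko_lyubich_class"
  then have te: "transcendental_entire f" by (simp add: eremenko_lyubich_class_def)
  have hol: "f holomorphic_on UNIV" using te by (simp add: transcendental_entire_def)
  obtain L where L: "\<And>r. 0 < r \<Longrightarrow> min_modulus f r \<le> exp L"
    using min_modulus_bounded_if_eremenko_lyubich[OF f] by blast
  \<comment> \<open>For large \<open>r\<close> the exponent \<open>1 - K / ln r\<close> is at least
    \<open>1 / 2\<close>, and \<open>exp (2 * L)\<close> to that power is already
    \<open>exp L\<close>. The lower bound 1 makes the power increasing in the exponent.\<close>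
  have "\<forall>\<^sub>F r in at_top. max 1 (exp (2 * L)) \<le> max_modulus f r"
    using max_modulus_at_top[OF hol transcendental_entire_nonconstant[OF te]] unfolding filterlim_at_top by blast
  moreover have "\<forall>\<^sub>F r in at_top. 2 * K \<le> ln r"
    using ln_at_top unfolding filterlim_at_top by blast
  moreover have "\<forall>\<^sub>F r in at_top. (1::real) \<le> r" by (rule eventually_ge_at_top)
  ultimately have "\<forall>\<^sub>F r in at_top. min_modulus f r \<le> max_modulus f r powr (1 - K / ln r)"
  proof eventually_elim
    case (elim r)
    have "exp L = exp (2 * L) powr (1 / 2)" by (simp add: powr_def)
    also have "\<dots> \<le> max_modulus f r powr (1 / 2)" using elim(1) by (intro powr_mono2) auto
    also have "\<dots> \<le> max_modulus f r powr (1 - K / ln r)"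
      using elim(1,2) K by (intro powr_mono) (auto simp: field_simps)
    finally show ?case using L[of r] elim(3) by simp
  qed
  then obtain R where "\<And>r. r \<ge> R \<Longrightarrow> min_modulus f r \<le> max_modulus f r powr (1 - K / ln r)"
    unfolding eventually_at_top_linorder by blast
  then show "log_regular f" by (rule log_regular_if_min_modulus_small[OF K te])
qed

end
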